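(* Let $R$ be a commutative ring with unit, $I$ an ideal of $R$, and $M$ and $\{M_\lambda\}_{\lambda\in\Lambda}$ $R$-modules. (1) $H_R(I,\prod_{\lambda\in\Lambda}M_\lambda)=\prod_{\lambda\in\Lambda}H_R(I,M_\lambda)$. (2) If $I$ is finitely generated, then $H_R(I,\bigoplus_{\lambda\in\Lambda}M_\lambda)=\bigoplus_{\lambda\in\Lambda}H_R(I,M_\lambda)$. (3) If $J=\mathrm{ann}(M)$, then $H_R(I,M)=H_{R/J}((I+J)/J,M)$. (4) If $S\subseteq R$ is a multiplicative set and $I$ is finitely generated, then the natural map induced by localisation identifies $S^{-1}H_R(I,M)$ with a submodule of $H_{S^{-1}R}(S^{-1}I,S^{-1}M)$ (i.e. this map is injective).
   Context: For a ring $R$, an ideal $I$ and an $R$-module $M$: $Z_R(I,M)=\{\varphi\in\mathrm{Hom}_R(I,M):\varphi(t)\in tM\text{ for all }t\in I\}$; $B_R(I,M)$ is the submodule of $\varphi\in Z_R(I,M)$ for which there exists $m\in M$ with $\varphi(t)=tm$ for all $t\in I$ (principal homomorphisms); $H_R(I,M)=Z_R(I,M)/B_R(I,M)$. A homomorphism $M\to N$ induces $H_R(I,M)\to H_R(I,N)$ by composition; localisation $\varphi\mapsto\varphi_S$ induces $S^{-1}H_R(I,M)\to H_{S^{-1}R}(S^{-1}I,S^{-1}M)$. *)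

theory Defs
  imports "HOL-Algebra.Algebra" "HOL-Library.FuncSet"
begin

definition is_mod_hom where
  "is_mod_hom R A B f \<longleftrightarrow> f \<in> carrier A \<rightarrow> carrier B \<and>
     (\<forall>x\<in>carrier A. \<forall>y\<in>carrier A. f (x \<oplus>\<^bsub>A\<^esub> y) = f x \<oplus>\<^bsub>B\<^esub> f y) \<and>
     (\<forall>r\<in>carrier R. \<forall>x\<in>carrier A. f (r \<odot>\<^bsub>A\<^esub> x) = r \<odot>\<^bsub>B\<^esub> f x)"

definition is_mod_iso where
  "is_mod_iso R A B f \<longleftrightarrow> is_mod_hom R A B f \<and> bij_betw f (carrier A) (carrier B)"

definition hom_lin where
  "hom_lin R I M = {\<phi>. \<phi> \<in> I \<rightarrow>\<^sub>E carrier M \<and>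
     (\<forall>s\<in>I. \<forall>t\<in>I. \<phi> (s \<oplus>\<^bsub>R\<^esub> t) = \<phi> s \<oplus>\<^bsub>M\<^esub> \<phi> t) \<and>
     (\<forall>r\<in>carrier R. \<forall>t\<in>I. \<phi> (r \<otimes>\<^bsub>R\<^esub> t) = r \<odot>\<^bsub>M\<^esub> \<phi> t)}"

definition Zset where
  "Zset R I M = {\<phi> \<in> hom_lin R I M. \<forall>t\<in>I. \<exists>m\<in>carrier M. \<phi> t = t \<odot>\<^bsub>M\<^esub> m}"

definition Bset where
  "Bset R I M = {\<phi> \<in> Zset R I M. \<exists>m\<in>carrier M. \<forall>t\<in>I. \<phi> t = t \<odot>\<^bsub>M\<^esub> m}"

definition hadd where "hadd I M \<phi> \<psi> = (\<lambda>t\<in>I. \<phi> t \<oplus>\<^bsub>M\<^esub> \<psi> t)"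
definition hsmult where "hsmult I M r \<phi> = (\<lambda>t\<in>I. r \<odot>\<^bsub>M\<^esub> \<phi> t)"

definition Hclass where
  "Hclass R I M \<phi> = {hadd I M \<phi> \<psi> | \<psi>. \<psi> \<in> Bset R I M}"

definition Hmod :: "('a,'c) ring_scheme \<Rightarrow> 'a set \<Rightarrow> ('a,'b,'d) module_scheme
     \<Rightarrow> ('a, ('a \<Rightarrow> 'b) set) module" where
  "Hmod R I M = \<lparr>carrier = Hclass R I M ` Zset R I M, monoid.mult = undefined, monoid.one = undefined,
     ring.zero = Bset R I M,
     ring.add = (\<lambda>U V. Hclass R I M (hadd I M (SOME \<phi>. \<phi> \<in> U) (SOME \<psi>. \<psi> \<in> V))),
     module.smult = (\<lambda>r Xa. Hclass R I M (hsmult I M r (SOME \<phi>. \<phi> \<in> Xa)))\<rparr>"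

definition Hmap where
  "Hmap R I N f Xa = Hclass R I N (\<lambda>t\<in>I. f ((SOME \<phi>. \<phi> \<in> Xa) t))"

definition prod_mod :: "('a,'c) ring_scheme \<Rightarrow> 'l set \<Rightarrow> ('l \<Rightarrow> ('a,'b,'d) module_scheme)
     \<Rightarrow> ('a, 'l \<Rightarrow> 'b) module" where
  "prod_mod R \<Lambda> M = \<lparr>carrier = Pi\<^sub>E \<Lambda> (\<lambda>l. carrier (M l)), monoid.mult = undefined, monoid.one = undefined,
     ring.zero = (\<lambda>l\<in>\<Lambda>. \<zero>\<^bsub>M l\<^esub>),
     ring.add = (\<lambda>x y. \<lambda>l\<in>\<Lambda>. x l \<oplus>\<^bsub>M l\<^esub> y l),
     module.smult = (\<lambda>r x. \<lambda>l\<in>\<Lambda>. r \<odot>\<^bsub>M l\<^esub> x l)\<rparr>"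

definition dsum_mod :: "('a,'c) ring_scheme \<Rightarrow> 'l set \<Rightarrow> ('l \<Rightarrow> ('a,'b,'d) module_scheme)
     \<Rightarrow> ('a, 'l \<Rightarrow> 'b) module" where
  "dsum_mod R \<Lambda> M = \<lparr>carrier = {x \<in> Pi\<^sub>E \<Lambda> (\<lambda>l. carrier (M l)). finite {l\<in>\<Lambda>. x l \<noteq> \<zero>\<^bsub>M l\<^esub>}},
     monoid.mult = undefined, monoid.one = undefined,
     ring.zero = (\<lambda>l\<in>\<Lambda>. \<zero>\<^bsub>M l\<^esub>),
     ring.add = (\<lambda>x y. \<lambda>l\<in>\<Lambda>. x l \<oplus>\<^bsub>M l\<^esub> y l),
     module.smult = (\<lambda>r x. \<lambda>l\<in>\<Lambda>. r \<odot>\<^bsub>M l\<^esub> x l)\<rparr>"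

definition can_prod where
  "can_prod R I \<Lambda> M Xa = (\<lambda>l\<in>\<Lambda>. Hmap R I (M l) (\<lambda>x. x l) Xa)"

definition ann_mod where
  "ann_mod R M = {r \<in> carrier R. \<forall>m\<in>carrier M. r \<odot>\<^bsub>M\<^esub> m = \<zero>\<^bsub>M\<^esub>}"

text \<open>M regarded as an R/J-module (J contained in ann M): (J + r) . m = r . m\<close>
definition quot_mod :: "('a,'c) ring_scheme \<Rightarrow> 'a set \<Rightarrow> ('a,'b,'d) module_scheme
     \<Rightarrow> ('a set, 'b) module" where
  "quot_mod R J M = \<lparr>carrier = carrier M, monoid.mult = monoid.mult M, monoid.one = monoid.one M, ring.zero = ring.zero M,
     ring.add = ring.add M, module.smult = (\<lambda>c m. (SOME r. r \<in> c) \<odot>\<^bsub>M\<^esub> m)\<rparr>"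

definition quot_ideal where
  "quot_ideal R I J = (\<lambda>x. J +>\<^bsub>R\<^esub> x) ` (I <+>\<^bsub>R\<^esub> J)"

definition can_quot where
  "can_quot R I J M Xa =
     (let \<phi> = SOME \<phi>. \<phi> \<in> Xa in
      Hclass (R Quot J) (quot_ideal R I J) (quot_mod R J M)
        (\<lambda>c\<in>quot_ideal R I J. \<phi> (SOME t. t \<in> I \<and> c = J +>\<^bsub>R\<^esub> t)))"

definition mult_set where
  "mult_set R S \<longleftrightarrow> S \<subseteq> carrier R \<and> \<one>\<^bsub>R\<^esub> \<in> S \<and> (\<forall>s\<in>S. \<forall>u\<in>S. s \<otimes>\<^bsub>R\<^esub> u \<in> S)"

text \<open>The fraction m/s in S^{-1}M, as an equivalence class of pairs.\<close>
definition loc_cls where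
  "loc_cls R S M m s = {(m', s'). m' \<in> carrier M \<and> s' \<in> S \<and>
     (\<exists>u\<in>S. u \<odot>\<^bsub>M\<^esub> ((s' \<odot>\<^bsub>M\<^esub> m) \<ominus>\<^bsub>M\<^esub> (s \<odot>\<^bsub>M\<^esub> m')) = \<zero>\<^bsub>M\<^esub>)}"

definition ring_mod :: "('a,'c) ring_scheme \<Rightarrow> ('a,'a) module" where
  "ring_mod R = \<lparr>carrier = carrier R, monoid.mult = monoid.mult R, monoid.one = monoid.one R, ring.zero = ring.zero R,
     ring.add = ring.add R, module.smult = monoid.mult R\<rparr>"

definition loc_ring :: "('a,'c) ring_scheme \<Rightarrow> 'a set \<Rightarrow> ('a \<times> 'a) set ring" where
  "loc_ring R S = \<lparr>carrier = {loc_cls R S (ring_mod R) r s | r s. r \<in> carrier R \<and> s \<in> S},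
     monoid.mult = (\<lambda>U V. case (SOME p. p \<in> U, SOME q. q \<in> V) of ((a, s), (b, u)) \<Rightarrow>
               loc_cls R S (ring_mod R) (a \<otimes>\<^bsub>R\<^esub> b) (s \<otimes>\<^bsub>R\<^esub> u)),
     monoid.one = loc_cls R S (ring_mod R) \<one>\<^bsub>R\<^esub> \<one>\<^bsub>R\<^esub>,
     ring.zero = loc_cls R S (ring_mod R) \<zero>\<^bsub>R\<^esub> \<one>\<^bsub>R\<^esub>,
     ring.add = (\<lambda>U V. case (SOME p. p \<in> U, SOME q. q \<in> V) of ((a, s), (b, u)) \<Rightarrow>
               loc_cls R S (ring_mod R) ((u \<otimes>\<^bsub>R\<^esub> a) \<oplus>\<^bsub>R\<^esub> (s \<otimes>\<^bsub>R\<^esub> b)) (s \<otimes>\<^bsub>R\<^esub> u))\<rparr>"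

definition loc_mod :: "('a,'c) ring_scheme \<Rightarrow> 'a set \<Rightarrow> ('a,'b,'d) module_scheme
     \<Rightarrow> (('a \<times> 'a) set, ('b \<times> 'a) set) module" where
  "loc_mod R S M = \<lparr>carrier = {loc_cls R S M m s | m s. m \<in> carrier M \<and> s \<in> S},
     monoid.mult = undefined, monoid.one = undefined,
     ring.zero = loc_cls R S M \<zero>\<^bsub>M\<^esub> \<one>\<^bsub>R\<^esub>,
     ring.add = (\<lambda>U V. case (SOME p. p \<in> U, SOME q. q \<in> V) of ((m, s), (n, u)) \<Rightarrow>
               loc_cls R S M ((u \<odot>\<^bsub>M\<^esub> m) \<oplus>\<^bsub>M\<^esub> (s \<odot>\<^bsub>M\<^esub> n)) (s \<otimes>\<^bsub>R\<^esub> u)),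
     module.smult = (\<lambda>A Xa. case (SOME p. p \<in> A, SOME q. q \<in> Xa) of ((a, s), (m, u)) \<Rightarrow>
               loc_cls R S M (a \<odot>\<^bsub>M\<^esub> m) (s \<otimes>\<^bsub>R\<^esub> u))\<rparr>"

definition loc_ideal where
  "loc_ideal R S I = {loc_cls R S (ring_mod R) t s | t s. t \<in> I \<and> s \<in> S}"

definition loc_hom where
  "loc_hom R S I M \<phi> = (\<lambda>c\<in>loc_ideal R S I.
      case (SOME p. p \<in> c \<and> fst p \<in> I) of (t, u) \<Rightarrow> loc_cls R S M (\<phi> t) u)"

text \<open>Natural map S^{-1}H_R(I,M) -> H_{S^{-1}R}(S^{-1}I, S^{-1}M): [phi]/s |-> [(1/s) phi_S].\<close>
definition can_loc where
  "can_loc R S I M \<xi> =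
     (case SOME p. p \<in> \<xi> of (Xa, s) \<Rightarrow>
        Hclass (loc_ring R S) (loc_ideal R S I) (loc_mod R S M)
          (\<lambda>c\<in>loc_ideal R S I.
              loc_cls R S (ring_mod R) \<one>\<^bsub>R\<^esub> s \<odot>\<^bsub>loc_mod R S M\<^esub>
                loc_hom R S I M (SOME \<phi>. \<phi> \<in> Xa) c))"

definition fin_gen_ideal where
  "fin_gen_ideal R I \<longleftrightarrow> (\<exists>G. finite G \<and> G \<subseteq> carrier R \<and> I = Idl\<^bsub>R\<^esub> G)"

end

(*
  An element of H_R(I,M) is the class of a cocycle phi in Z_R(I,M), and two cocycles have the
  same class iff they differ by a principal map t |-> t m (they are "cohomologous"), so all four
  statements are proved on representatives.

  (1), (2): a cocycle or principal map into a product is the same as a family of cocycles or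
  principal maps into the factors. For the direct sum one needs in addition that a cocycle phi
  into the sum has only finitely many nonzero components; this holds when I is generated by a
  finite set G, because a component vanishing on G vanishes on I and phi(G) is a finite set of
  finitely supported families.

  (3): if J annihilates M, then phi(j) = j m = 0 for j in I and J, so phi(t) only depends on
  the coset t + J and phi descends to (I + J)/J; this is a bijection on cocycles that preserves
  principal maps in both directions.

  (4): if (1/s) phi_S and (1/s') psi_S are cohomologous, then for every t in I some v in S
  satisfies v s' w phi(t) = v (s w psi(t) + t s s' m). Finite generation of I yields one v
  that works on the generators and hence on all of I, so v w s' [phi] = v w s [psi] in
  H_R(I,M), that is [phi]/s = [psi]/s'.
*)

theory Submission
  imports Defs
begin

section \<open>Cocycles and the module H_R(I,M)\<close>

definition cohomologous where
  "cohomologous I M \<phi> \<psi> \<longleftrightarrow> (\<exists>m\<in>carrier M. \<forall>t\<in>I. \<psi> t = \<phi> t \<oplus>\<^bsub>M\<^esub> t \<odot>\<^bsub>M\<^esub> m)"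

lemma Bset_subset_Zset: "Bset R I M \<subseteq> Zset R I M"
  unfolding Bset_def by auto

lemma Zset_subset_hom_lin: "Zset R I M \<subseteq> hom_lin R I M"
  unfolding Zset_def by auto

lemma Hmod_carrier: "carrier (Hmod R I M) = Hclass R I M ` Zset R I M"
  unfolding Hmod_def by simp

lemma HmodE:
  assumes "x \<in> carrier (Hmod R I M)"
  obtains \<phi> where "\<phi> \<in> Zset R I M" "x = Hclass R I M \<phi>"
  using assms unfolding Hmod_carrier by blast

lemma Hclass_in_Hmod: "\<phi> \<in> Zset R I M \<Longrightarrow> Hclass R I M \<phi> \<in> carrier (Hmod R I M)"
  unfolding Hmod_carrier by blast

text \<open>No module structure on \<open>M\<close> is assumed, so that this also applies over the localisation,
  where the module axioms of \<open>loc_mod\<close> are never established.\<close>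

lemma Hclass_self_if_zero_map_in_Bset:
  assumes "(\<lambda>t\<in>I. \<zero>\<^bsub>M\<^esub>) \<in> Bset R I M" and "\<phi> \<in> I \<rightarrow>\<^sub>E carrier M"
    and "\<And>x. x \<in> carrier M \<Longrightarrow> x \<oplus>\<^bsub>M\<^esub> \<zero>\<^bsub>M\<^esub> = x"
  shows "\<phi> \<in> Hclass R I M \<phi>"
proof -
  have "hadd I M \<phi> (\<lambda>t\<in>I. \<zero>\<^bsub>M\<^esub>) = \<phi>"
    using assms(2,3) by (auto simp: hadd_def PiE_iff extensional_def)
  then show ?thesis
    unfolding Hclass_def using assms(1) by (metis (mono_tags, lifting) mem_Collect_eq)
qed

text \<open>Only the closure properties of an ideal are assumed, so that the locale also applies to
  \<open>(I + J)/J\<close> inside \<open>R/J\<close>.\<close>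

locale module_ideal = module +
  fixes I :: "'a set"
  assumes I_subset: "I \<subseteq> carrier R"
    and I_add_closed: "\<lbrakk>s \<in> I; t \<in> I\<rbrakk> \<Longrightarrow> s \<oplus> t \<in> I"
    and I_mult_closed: "\<lbrakk>r \<in> carrier R; t \<in> I\<rbrakk> \<Longrightarrow> r \<otimes> t \<in> I"
begin

lemma I_carrier: "t \<in> I \<Longrightarrow> t \<in> carrier R"
  using I_subset by auto

lemma smult_commute:
  "\<lbrakk>a \<in> carrier R; b \<in> carrier R; x \<in> carrier M\<rbrakk> \<Longrightarrow> a \<odot>\<^bsub>M\<^esub> (b \<odot>\<^bsub>M\<^esub> x) = b \<odot>\<^bsub>M\<^esub> (a \<odot>\<^bsub>M\<^esub> x)"
  by (metis smult_assoc1 m_comm)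

lemma ZsetI:
  assumes "\<phi> \<in> I \<rightarrow>\<^sub>E carrier M"
    and "\<And>s t. s \<in> I \<Longrightarrow> t \<in> I \<Longrightarrow> \<phi> (s \<oplus> t) = \<phi> s \<oplus>\<^bsub>M\<^esub> \<phi> t"
    and "\<And>r t. r \<in> carrier R \<Longrightarrow> t \<in> I \<Longrightarrow> \<phi> (r \<otimes> t) = r \<odot>\<^bsub>M\<^esub> \<phi> t"
    and "\<And>t. t \<in> I \<Longrightarrow> \<exists>m\<in>carrier M. \<phi> t = t \<odot>\<^bsub>M\<^esub> m"
  shows "\<phi> \<in> Zset R I M"
  using assms unfolding Zset_def hom_lin_def by auto

lemma ZsetD:
  assumes "\<phi> \<in> Zset R I M"
  shows "\<phi> \<in> I \<rightarrow>\<^sub>E carrier M"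
    and "\<And>s t. s \<in> I \<Longrightarrow> t \<in> I \<Longrightarrow> \<phi> (s \<oplus> t) = \<phi> s \<oplus>\<^bsub>M\<^esub> \<phi> t"
    and "\<And>r t. r \<in> carrier R \<Longrightarrow> t \<in> I \<Longrightarrow> \<phi> (r \<otimes> t) = r \<odot>\<^bsub>M\<^esub> \<phi> t"
    and "\<And>t. t \<in> I \<Longrightarrow> \<exists>m\<in>carrier M. \<phi> t = t \<odot>\<^bsub>M\<^esub> m"
  using assms unfolding Zset_def hom_lin_def by auto

lemma Zset_closed: "\<phi> \<in> Zset R I M \<Longrightarrow> t \<in> I \<Longrightarrow> \<phi> t \<in> carrier M"
  using ZsetD(1) by blast

lemma Zset_undefined: "\<phi> \<in> Zset R I M \<Longrightarrow> t \<notin> I \<Longrightarrow> \<phi> t = undefined"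
  using ZsetD(1) by (auto simp: PiE_def extensional_def)

lemma principal_Zset:
  assumes m: "m \<in> carrier M"
  shows "(\<lambda>t\<in>I. t \<odot>\<^bsub>M\<^esub> m) \<in> Zset R I M"
  by (rule ZsetI)
    (use m I_carrier I_add_closed I_mult_closed in \<open>auto simp: smult_l_distr smult_assoc1\<close>)

lemma principal_Bset: "m \<in> carrier M \<Longrightarrow> (\<lambda>t\<in>I. t \<odot>\<^bsub>M\<^esub> m) \<in> Bset R I M"
  using principal_Zset unfolding Bset_def by auto

lemma zero_map_Bset: "(\<lambda>t\<in>I. \<zero>\<^bsub>M\<^esub>) \<in> Bset R I M"
proof -
  have "(\<lambda>t\<in>I. \<zero>\<^bsub>M\<^esub>) = (\<lambda>t\<in>I. t \<odot>\<^bsub>M\<^esub> \<zero>\<^bsub>M\<^esub>)"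
    using I_carrier by (auto intro!: restrict_ext)
  then show ?thesis using principal_Bset[of "\<zero>\<^bsub>M\<^esub>"] by simp
qed

lemma zero_map_Zset: "(\<lambda>t\<in>I. \<zero>\<^bsub>M\<^esub>) \<in> Zset R I M"
  using zero_map_Bset Bset_subset_Zset by blast

lemma hadd_Zset:
  assumes "\<phi> \<in> Zset R I M" "\<psi> \<in> Zset R I M"
  shows "hadd I M \<phi> \<psi> \<in> Zset R I M"
proof (rule ZsetI)
  note closed = Zset_closed[OF assms(1)] Zset_closed[OF assms(2)]
  show "hadd I M \<phi> \<psi> \<in> I \<rightarrow>\<^sub>E carrier M"
    using closed by (auto simp: hadd_def)
  show "hadd I M \<phi> \<psi> (s \<oplus> t) = hadd I M \<phi> \<psi> s \<oplus>\<^bsub>M\<^esub> hadd I M \<phi> \<psi> t" if "s \<in> I" "t \<in> I" for s t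
    using that I_add_closed closed ZsetD(2)[OF assms(1)] ZsetD(2)[OF assms(2)]
    by (simp add: hadd_def M.a_ac)
  show "hadd I M \<phi> \<psi> (r \<otimes> t) = r \<odot>\<^bsub>M\<^esub> hadd I M \<phi> \<psi> t" if "r \<in> carrier R" "t \<in> I" for r t
    using that I_mult_closed closed ZsetD(3)[OF assms(1)] ZsetD(3)[OF assms(2)]
    by (simp add: hadd_def smult_r_distr)
  show "\<exists>m\<in>carrier M. hadd I M \<phi> \<psi> t = t \<odot>\<^bsub>M\<^esub> m" if t: "t \<in> I" for t
  proof -
    obtain m1 where "m1 \<in> carrier M" "\<phi> t = t \<odot>\<^bsub>M\<^esub> m1" using ZsetD(4)[OF assms(1) t] by blast
    moreover obtain m2 where "m2 \<in> carrier M" "\<psi> t = t \<odot>\<^bsub>M\<^esub> m2" using ZsetD(4)[OF assms(2) t] by blast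
    ultimately show ?thesis
      using t I_carrier by (auto simp: hadd_def smult_r_distr intro!: bexI[of _ "m1 \<oplus>\<^bsub>M\<^esub> m2"])
  qed
qed

lemma hsmult_Zset:
  assumes r: "r \<in> carrier R" and \<phi>: "\<phi> \<in> Zset R I M"
  shows "hsmult I M r \<phi> \<in> Zset R I M"
proof (rule ZsetI)
  note closed = Zset_closed[OF \<phi>]
  show "hsmult I M r \<phi> \<in> I \<rightarrow>\<^sub>E carrier M"
    using closed r by (auto simp: hsmult_def)
  show "hsmult I M r \<phi> (s \<oplus> t) = hsmult I M r \<phi> s \<oplus>\<^bsub>M\<^esub> hsmult I M r \<phi> t" if "s \<in> I" "t \<in> I" for s t
    using that I_add_closed closed ZsetD(2)[OF \<phi>] r by (simp add: hsmult_def smult_r_distr)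
  show "hsmult I M r \<phi> (a \<otimes> t) = a \<odot>\<^bsub>M\<^esub> hsmult I M r \<phi> t" if "a \<in> carrier R" "t \<in> I" for a t
    using that I_mult_closed closed ZsetD(3)[OF \<phi>] r by (simp add: hsmult_def smult_commute)
  show "\<exists>m\<in>carrier M. hsmult I M r \<phi> t = t \<odot>\<^bsub>M\<^esub> m" if t: "t \<in> I" for t
  proof -
    obtain m where "m \<in> carrier M" "\<phi> t = t \<odot>\<^bsub>M\<^esub> m" using ZsetD(4)[OF \<phi> t] by blast
    then show ?thesis
      using t I_carrier r by (auto simp: hsmult_def smult_commute intro!: bexI[of _ "r \<odot>\<^bsub>M\<^esub> m"])
  qed
qed

lemma cohomologous_refl: "\<phi> \<in> Zset R I M \<Longrightarrow> cohomologous I M \<phi> \<phi>"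
  unfolding cohomologous_def using Zset_closed I_carrier by (auto intro!: bexI[of _ "\<zero>\<^bsub>M\<^esub>"])

lemma cohomologous_sym:
  assumes \<phi>: "\<phi> \<in> Zset R I M" and "cohomologous I M \<phi> \<psi>"
  shows "cohomologous I M \<psi> \<phi>"
proof -
  obtain m where m: "m \<in> carrier M" "\<forall>t\<in>I. \<psi> t = \<phi> t \<oplus>\<^bsub>M\<^esub> t \<odot>\<^bsub>M\<^esub> m"
    using assms(2) unfolding cohomologous_def by auto
  then have "\<forall>t\<in>I. \<phi> t = \<psi> t \<oplus>\<^bsub>M\<^esub> t \<odot>\<^bsub>M\<^esub> (\<ominus>\<^bsub>M\<^esub> m)"
    using Zset_closed[OF \<phi>] I_carrier by (simp add: smult_r_minus M.a_assoc M.r_neg)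
  then show ?thesis
    using m unfolding cohomologous_def by auto
qed

lemma cohomologous_trans:
  assumes \<phi>: "\<phi> \<in> Zset R I M" and "cohomologous I M \<phi> \<psi>" "cohomologous I M \<psi> \<chi>"
  shows "cohomologous I M \<phi> \<chi>"
proof -
  obtain m where m: "m \<in> carrier M" "\<forall>t\<in>I. \<psi> t = \<phi> t \<oplus>\<^bsub>M\<^esub> t \<odot>\<^bsub>M\<^esub> m"
    using assms(2) unfolding cohomologous_def by auto
  obtain n where n: "n \<in> carrier M" "\<forall>t\<in>I. \<chi> t = \<psi> t \<oplus>\<^bsub>M\<^esub> t \<odot>\<^bsub>M\<^esub> n"
    using assms(3) unfolding cohomologous_def by auto
  have "\<forall>t\<in>I. \<chi> t = \<phi> t \<oplus>\<^bsub>M\<^esub> t \<odot>\<^bsub>M\<^esub> (m \<oplus>\<^bsub>M\<^esub> n)"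
    using m n Zset_closed[OF \<phi>] I_carrier by (simp add: smult_r_distr M.a_assoc)
  then show ?thesis
    using m n unfolding cohomologous_def by auto
qed

lemma Hclass_mem_iff:
  assumes \<phi>: "\<phi> \<in> Zset R I M"
  shows "\<psi> \<in> Hclass R I M \<phi> \<longleftrightarrow> \<psi> \<in> Zset R I M \<and> cohomologous I M \<phi> \<psi>"
proof
  assume "\<psi> \<in> Hclass R I M \<phi>"
  then obtain b where b: "b \<in> Bset R I M" "\<psi> = hadd I M \<phi> b"
    unfolding Hclass_def by auto
  then obtain m where "m \<in> carrier M" "\<forall>t\<in>I. b t = t \<odot>\<^bsub>M\<^esub> m"
    unfolding Bset_def by auto
  moreover have "hadd I M \<phi> b \<in> Zset R I M"
    using hadd_Zset[OF \<phi>] b(1) Bset_subset_Zset by blast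
  ultimately show "\<psi> \<in> Zset R I M \<and> cohomologous I M \<phi> \<psi>"
    using b(2) unfolding cohomologous_def by (auto simp: hadd_def)
next
  assume \<psi>: "\<psi> \<in> Zset R I M \<and> cohomologous I M \<phi> \<psi>"
  then obtain m where m: "m \<in> carrier M" "\<forall>t\<in>I. \<psi> t = \<phi> t \<oplus>\<^bsub>M\<^esub> t \<odot>\<^bsub>M\<^esub> m"
    unfolding cohomologous_def by auto
  have "\<psi> = hadd I M \<phi> (\<lambda>t\<in>I. t \<odot>\<^bsub>M\<^esub> m)"
    using m Zset_undefined \<psi> by (auto simp: hadd_def)
  then show "\<psi> \<in> Hclass R I M \<phi>"
    unfolding Hclass_def using principal_Bset[OF m(1)] by blast
qed

lemma Hclass_eq_iff:
  assumes "\<phi> \<in> Zset R I M" "\<psi> \<in> Zset R I M"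
  shows "Hclass R I M \<phi> = Hclass R I M \<psi> \<longleftrightarrow> cohomologous I M \<phi> \<psi>"
  using Hclass_mem_iff assms cohomologous_refl cohomologous_sym cohomologous_trans by blast

lemma some_Hclass:
  assumes \<phi>: "\<phi> \<in> Zset R I M"
  shows "(SOME \<psi>. \<psi> \<in> Hclass R I M \<phi>) \<in> Zset R I M"
    and "cohomologous I M \<phi> (SOME \<psi>. \<psi> \<in> Hclass R I M \<phi>)"
proof -
  have "\<phi> \<in> Hclass R I M \<phi>"
    using Hclass_mem_iff[OF \<phi>] cohomologous_refl[OF \<phi>] \<phi> by blast
  then have "(SOME \<psi>. \<psi> \<in> Hclass R I M \<phi>) \<in> Hclass R I M \<phi>"
    by (rule someI[where P="\<lambda>\<psi>. \<psi> \<in> Hclass R I M \<phi>"])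
  then show "(SOME \<psi>. \<psi> \<in> Hclass R I M \<phi>) \<in> Zset R I M"
    and "cohomologous I M \<phi> (SOME \<psi>. \<psi> \<in> Hclass R I M \<phi>)"
    using Hclass_mem_iff[OF \<phi>] by auto
qed

lemma hadd_cohomologous:
  assumes "\<phi> \<in> Zset R I M" "\<psi> \<in> Zset R I M" "cohomologous I M \<phi> \<phi>'" "cohomologous I M \<psi> \<psi>'"
  shows "cohomologous I M (hadd I M \<phi> \<psi>) (hadd I M \<phi>' \<psi>')"
proof -
  obtain m where m: "m \<in> carrier M" "\<forall>t\<in>I. \<phi>' t = \<phi> t \<oplus>\<^bsub>M\<^esub> t \<odot>\<^bsub>M\<^esub> m"
    using assms(3) unfolding cohomologous_def by auto
  obtain n where n: "n \<in> carrier M" "\<forall>t\<in>I. \<psi>' t = \<psi> t \<oplus>\<^bsub>M\<^esub> t \<odot>\<^bsub>M\<^esub> n"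
    using assms(4) unfolding cohomologous_def by auto
  have "\<forall>t\<in>I. hadd I M \<phi>' \<psi>' t = hadd I M \<phi> \<psi> t \<oplus>\<^bsub>M\<^esub> t \<odot>\<^bsub>M\<^esub> (m \<oplus>\<^bsub>M\<^esub> n)"
    using m n Zset_closed[OF assms(1)] Zset_closed[OF assms(2)] I_carrier
    by (simp add: hadd_def smult_r_distr M.a_ac)
  then show ?thesis
    using m n unfolding cohomologous_def by auto
qed

lemma hsmult_cohomologous:
  assumes r: "r \<in> carrier R" and "\<phi> \<in> Zset R I M" "cohomologous I M \<phi> \<phi>'"
  shows "cohomologous I M (hsmult I M r \<phi>) (hsmult I M r \<phi>')"
proof -
  obtain m where m: "m \<in> carrier M" "\<forall>t\<in>I. \<phi>' t = \<phi> t \<oplus>\<^bsub>M\<^esub> t \<odot>\<^bsub>M\<^esub> m"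
    using assms(3) unfolding cohomologous_def by auto
  have "\<forall>t\<in>I. hsmult I M r \<phi>' t = hsmult I M r \<phi> t \<oplus>\<^bsub>M\<^esub> t \<odot>\<^bsub>M\<^esub> (r \<odot>\<^bsub>M\<^esub> m)"
    using m r Zset_closed[OF assms(2)] I_carrier by (simp add: hsmult_def smult_r_distr smult_commute)
  then show ?thesis
    using m r unfolding cohomologous_def by auto
qed

lemma Hmod_add:
  assumes "\<phi> \<in> Zset R I M" "\<psi> \<in> Zset R I M"
  shows "Hclass R I M \<phi> \<oplus>\<^bsub>Hmod R I M\<^esub> Hclass R I M \<psi> = Hclass R I M (hadd I M \<phi> \<psi>)"
  using assms some_Hclass hadd_Zset Hclass_eq_iff cohomologous_sym hadd_cohomologous
  unfolding Hmod_def by simp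

lemma Hmod_smult:
  assumes "r \<in> carrier R" "\<phi> \<in> Zset R I M"
  shows "r \<odot>\<^bsub>Hmod R I M\<^esub> Hclass R I M \<phi> = Hclass R I M (hsmult I M r \<phi>)"
  using assms some_Hclass hsmult_Zset Hclass_eq_iff cohomologous_sym hsmult_cohomologous
  unfolding Hmod_def by simp

lemma Hmod_zero: "\<zero>\<^bsub>Hmod R I M\<^esub> = Hclass R I M (\<lambda>t\<in>I. \<zero>\<^bsub>M\<^esub>)"
proof -
  have "Bset R I M = Hclass R I M (\<lambda>t\<in>I. \<zero>\<^bsub>M\<^esub>)"
    unfolding Bset_def set_eq_iff Hclass_mem_iff[OF zero_map_Zset] cohomologous_def
    using I_carrier by auto
  then show ?thesis
    unfolding Hmod_def by simp
qed

lemma Hmod_abelian_group: "abelian_group (Hmod R I M)"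
proof (rule abelian_groupI)
  fix x y assume x: "x \<in> carrier (Hmod R I M)" and y: "y \<in> carrier (Hmod R I M)"
  obtain \<phi> where \<phi>: "\<phi> \<in> Zset R I M" "x = Hclass R I M \<phi>"
    using x by (rule HmodE)
  obtain \<psi> where \<psi>: "\<psi> \<in> Zset R I M" "y = Hclass R I M \<psi>"
    using y by (rule HmodE)
  show "x \<oplus>\<^bsub>Hmod R I M\<^esub> y \<in> carrier (Hmod R I M)"
    unfolding \<phi>(2) \<psi>(2) Hmod_add[OF \<phi>(1) \<psi>(1)] using hadd_Zset[OF \<phi>(1) \<psi>(1)] by (rule Hclass_in_Hmod)
  have "hadd I M \<phi> \<psi> = hadd I M \<psi> \<phi>"
    using Zset_closed \<phi>(1) \<psi>(1) by (auto simp: hadd_def M.a_comm intro!: restrict_ext)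
  then show "x \<oplus>\<^bsub>Hmod R I M\<^esub> y = y \<oplus>\<^bsub>Hmod R I M\<^esub> x"
    unfolding \<phi>(2) \<psi>(2) Hmod_add[OF \<phi>(1) \<psi>(1)] Hmod_add[OF \<psi>(1) \<phi>(1)] by simp
next
  show "\<zero>\<^bsub>Hmod R I M\<^esub> \<in> carrier (Hmod R I M)"
    unfolding Hmod_zero using zero_map_Zset by (rule Hclass_in_Hmod)
next
  fix x y z
  assume x: "x \<in> carrier (Hmod R I M)" and y: "y \<in> carrier (Hmod R I M)" and z: "z \<in> carrier (Hmod R I M)"
  obtain \<phi> where \<phi>: "\<phi> \<in> Zset R I M" "x = Hclass R I M \<phi>"
    using x by (rule HmodE)
  obtain \<psi> where \<psi>: "\<psi> \<in> Zset R I M" "y = Hclass R I M \<psi>"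
    using y by (rule HmodE)
  obtain \<chi> where \<chi>: "\<chi> \<in> Zset R I M" "z = Hclass R I M \<chi>"
    using z by (rule HmodE)
  have "hadd I M (hadd I M \<phi> \<psi>) \<chi> = hadd I M \<phi> (hadd I M \<psi> \<chi>)"
    using Zset_closed \<phi>(1) \<psi>(1) \<chi>(1) by (auto simp: hadd_def M.a_assoc intro!: restrict_ext)
  then show "x \<oplus>\<^bsub>Hmod R I M\<^esub> y \<oplus>\<^bsub>Hmod R I M\<^esub> z = x \<oplus>\<^bsub>Hmod R I M\<^esub> (y \<oplus>\<^bsub>Hmod R I M\<^esub> z)"
    unfolding \<phi>(2) \<psi>(2) \<chi>(2)
    by (simp add: Hmod_add \<phi>(1) \<psi>(1) \<chi>(1) hadd_Zset)
next
  fix x assume "x \<in> carrier (Hmod R I M)"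
  then obtain \<phi> where \<phi>: "\<phi> \<in> Zset R I M" "x = Hclass R I M \<phi>"
    by (rule HmodE)
  have "hadd I M (\<lambda>t\<in>I. \<zero>\<^bsub>M\<^esub>) \<phi> = \<phi>"
    using Zset_closed[OF \<phi>(1)] Zset_undefined[OF \<phi>(1)] by (auto simp: hadd_def)
  then show "\<zero>\<^bsub>Hmod R I M\<^esub> \<oplus>\<^bsub>Hmod R I M\<^esub> x = x"
    unfolding \<phi>(2) Hmod_zero Hmod_add[OF zero_map_Zset \<phi>(1)] by simp
  have neg: "hsmult I M (\<ominus> \<one>) \<phi> \<in> Zset R I M"
    using hsmult_Zset \<phi>(1) by simp
  have "hadd I M (hsmult I M (\<ominus> \<one>) \<phi>) \<phi> = (\<lambda>t\<in>I. \<zero>\<^bsub>M\<^esub>)"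
    using Zset_closed[OF \<phi>(1)]
    by (auto simp: hadd_def hsmult_def smult_l_minus M.l_neg intro!: restrict_ext)
  then have "Hclass R I M (hsmult I M (\<ominus> \<one>) \<phi>) \<oplus>\<^bsub>Hmod R I M\<^esub> x = \<zero>\<^bsub>Hmod R I M\<^esub>"
    unfolding \<phi>(2) Hmod_zero Hmod_add[OF neg \<phi>(1)] by simp
  then show "\<exists>y\<in>carrier (Hmod R I M). y \<oplus>\<^bsub>Hmod R I M\<^esub> x = \<zero>\<^bsub>Hmod R I M\<^esub>"
    using Hclass_in_Hmod[OF neg] by blast
qed

lemma Hmod_module: "module R (Hmod R I M)"
proof (rule moduleI[OF is_cring Hmod_abelian_group])
  fix a x assume a: "a \<in> carrier R" and x: "x \<in> carrier (Hmod R I M)"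
  obtain \<phi> where \<phi>: "\<phi> \<in> Zset R I M" "x = Hclass R I M \<phi>"
    using x by (rule HmodE)
  show "a \<odot>\<^bsub>Hmod R I M\<^esub> x \<in> carrier (Hmod R I M)"
    unfolding \<phi>(2) Hmod_smult[OF a \<phi>(1)] using hsmult_Zset[OF a \<phi>(1)] by (rule Hclass_in_Hmod)
next
  fix a b x assume a: "a \<in> carrier R" and b: "b \<in> carrier R" and x: "x \<in> carrier (Hmod R I M)"
  obtain \<phi> where \<phi>: "\<phi> \<in> Zset R I M" "x = Hclass R I M \<phi>"
    using x by (rule HmodE)
  have "hsmult I M (a \<oplus> b) \<phi> = hadd I M (hsmult I M a \<phi>) (hsmult I M b \<phi>)"
    using a b Zset_closed[OF \<phi>(1)] by (auto simp: hadd_def hsmult_def smult_l_distr intro!: restrict_ext)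
  then show "(a \<oplus> b) \<odot>\<^bsub>Hmod R I M\<^esub> x = a \<odot>\<^bsub>Hmod R I M\<^esub> x \<oplus>\<^bsub>Hmod R I M\<^esub> b \<odot>\<^bsub>Hmod R I M\<^esub> x"
    unfolding \<phi>(2) by (simp add: Hmod_smult Hmod_add a b \<phi>(1) hsmult_Zset)
  have "hsmult I M (a \<otimes> b) \<phi> = hsmult I M a (hsmult I M b \<phi>)"
    using a b Zset_closed[OF \<phi>(1)] by (auto simp: hsmult_def smult_assoc1 intro!: restrict_ext)
  then show "(a \<otimes> b) \<odot>\<^bsub>Hmod R I M\<^esub> x = a \<odot>\<^bsub>Hmod R I M\<^esub> (b \<odot>\<^bsub>Hmod R I M\<^esub> x)"
    unfolding \<phi>(2) by (simp add: Hmod_smult a b \<phi>(1) hsmult_Zset)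
next
  fix a x y assume a: "a \<in> carrier R" and x: "x \<in> carrier (Hmod R I M)" and y: "y \<in> carrier (Hmod R I M)"
  obtain \<phi> where \<phi>: "\<phi> \<in> Zset R I M" "x = Hclass R I M \<phi>"
    using x by (rule HmodE)
  obtain \<psi> where \<psi>: "\<psi> \<in> Zset R I M" "y = Hclass R I M \<psi>"
    using y by (rule HmodE)
  have "hsmult I M a (hadd I M \<phi> \<psi>) = hadd I M (hsmult I M a \<phi>) (hsmult I M a \<psi>)"
    using a Zset_closed \<phi>(1) \<psi>(1) by (auto simp: hadd_def hsmult_def smult_r_distr intro!: restrict_ext)
  then show "a \<odot>\<^bsub>Hmod R I M\<^esub> (x \<oplus>\<^bsub>Hmod R I M\<^esub> y) = a \<odot>\<^bsub>Hmod R I M\<^esub> x \<oplus>\<^bsub>Hmod R I M\<^esub> a \<odot>\<^bsub>Hmod R I M\<^esub> y"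
    unfolding \<phi>(2) \<psi>(2) by (simp add: Hmod_smult Hmod_add a \<phi>(1) \<psi>(1) hsmult_Zset hadd_Zset)
next
  fix x assume "x \<in> carrier (Hmod R I M)"
  then obtain \<phi> where \<phi>: "\<phi> \<in> Zset R I M" "x = Hclass R I M \<phi>"
    by (rule HmodE)
  have "hsmult I M \<one> \<phi> = \<phi>"
    using Zset_closed[OF \<phi>(1)] Zset_undefined[OF \<phi>(1)] by (auto simp: hsmult_def)
  then show "\<one> \<odot>\<^bsub>Hmod R I M\<^esub> x = x"
    unfolding \<phi>(2) Hmod_smult[OF one_closed \<phi>(1)] by simp
qed

end

lemma module_idealI: "cring R \<Longrightarrow> ideal I R \<Longrightarrow> module R M \<Longrightarrow> module_ideal R M I"
  unfolding module_ideal_def module_ideal_axioms_def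
  by (auto intro: ideal.I_l_closed additive_subgroup.a_closed ideal.axioms(1)
      dest: additive_subgroup.a_Hcarr[OF ideal.axioms(1)])

lemma (in module) hom_lin_equalizer_ideal:
  assumes J: "ideal J R" and \<phi>: "\<phi> \<in> hom_lin R J M" and \<psi>: "\<psi> \<in> hom_lin R J M"
  shows "ideal {t\<in>J. \<phi> t = \<psi> t} R"
proof -
  let ?K = "{t\<in>J. \<phi> t = \<psi> t}"
  interpret J: ideal J R
    by (rule J)
  have zero_in: "\<zero> \<in> J"
    using additive_subgroup.zero_closed[OF J.additive_subgroup_axioms] .
  have add: "\<chi> (a \<oplus> b) = \<chi> a \<oplus>\<^bsub>M\<^esub> \<chi> b" if "\<chi> \<in> hom_lin R J M" "a \<in> J" "b \<in> J" for \<chi> a b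
    using that unfolding hom_lin_def by auto
  have mult: "\<chi> (r \<otimes> a) = r \<odot>\<^bsub>M\<^esub> \<chi> a" if "\<chi> \<in> hom_lin R J M" "r \<in> carrier R" "a \<in> J" for \<chi> r a
    using that unfolding hom_lin_def by auto
  have zero: "\<chi> \<zero> = \<zero>\<^bsub>M\<^esub>" if "\<chi> \<in> hom_lin R J M" for \<chi>
  proof -
    have "\<chi> \<zero> \<in> carrier M"
      using that zero_in unfolding hom_lin_def by auto
    then show ?thesis
      using mult[OF that R.zero_closed zero_in] by simp
  qed
  have K_mult_closed: "r \<otimes> a \<in> ?K" if "a \<in> ?K" "r \<in> carrier R" for r a
    using that mult[OF \<phi>] mult[OF \<psi>] J.I_l_closed by auto
  show ?thesis
  proof (rule idealI[OF R.ring_axioms])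
    show "subgroup ?K (add_monoid R)"
    proof (rule R.add.subgroupI)
      show "?K \<subseteq> carrier R"
        using J.a_subset by auto
      have "\<zero> \<in> ?K"
        using zero[OF \<phi>] zero[OF \<psi>] zero_in by simp
      then show "?K \<noteq> {}"
        by blast
    next
      fix a assume a: "a \<in> ?K"
      then show "\<ominus> a \<in> ?K"
        using K_mult_closed[OF a, of "\<ominus> \<one>"] J.a_subset by (auto simp: l_minus)
    next
      fix a b assume "a \<in> ?K" "b \<in> ?K"
      then show "a \<oplus> b \<in> ?K"
        using add[OF \<phi>] add[OF \<psi>] J.a_closed by auto
    qed
  next
    fix a x assume "a \<in> ?K" "x \<in> carrier R"
    then show "x \<otimes> a \<in> ?K" "a \<otimes> x \<in> ?K"
      using K_mult_closed J.a_subset m_comm by auto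
  qed
qed

lemma (in module) hom_lin_eq_on_generators:
  assumes G: "G \<subseteq> carrier R" and \<phi>: "\<phi> \<in> hom_lin R (Idl G) M" and \<psi>: "\<psi> \<in> hom_lin R (Idl G) M"
    and eq: "\<And>g. g \<in> G \<Longrightarrow> \<phi> g = \<psi> g" and t: "t \<in> Idl G"
  shows "\<phi> t = \<psi> t"
proof -
  have "G \<subseteq> {t\<in>Idl G. \<phi> t = \<psi> t}"
    using genideal_self[OF G] eq by blast
  then have "Idl G \<subseteq> {t\<in>Idl G. \<phi> t = \<psi> t}"
    by (rule genideal_minimal[OF hom_lin_equalizer_ideal[OF genideal_ideal[OF G] \<phi> \<psi>]])
  then show ?thesis
    using t by blast
qed

lemma Hmap_Hclass:
  assumes M: "module_ideal R M I" and N: "module_ideal R N I" and f: "is_mod_hom R M N f"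
    and \<phi>: "\<phi> \<in> Zset R I M"
  shows "(\<lambda>t\<in>I. f (\<phi> t)) \<in> Zset R I N"
    and "Hmap R I N f (Hclass R I M \<phi>) = Hclass R I N (\<lambda>t\<in>I. f (\<phi> t))"
proof -
  interpret M: module_ideal R M I by fact
  interpret N: module_ideal R N I by fact
  have f_closed: "f x \<in> carrier N" if "x \<in> carrier M" for x
    using f that unfolding is_mod_hom_def by auto
  have f_add: "f (x \<oplus>\<^bsub>M\<^esub> y) = f x \<oplus>\<^bsub>N\<^esub> f y" if "x \<in> carrier M" "y \<in> carrier M" for x y
    using f that unfolding is_mod_hom_def by auto
  have f_smult: "f (r \<odot>\<^bsub>M\<^esub> x) = r \<odot>\<^bsub>N\<^esub> f x" if "r \<in> carrier R" "x \<in> carrier M" for r x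
    using f that unfolding is_mod_hom_def by auto
  have comp: "(\<lambda>t\<in>I. f (\<chi> t)) \<in> Zset R I N" if \<chi>: "\<chi> \<in> Zset R I M" for \<chi>
  proof (rule N.ZsetI)
    show "\<exists>n\<in>carrier N. (\<lambda>t\<in>I. f (\<chi> t)) t = t \<odot>\<^bsub>N\<^esub> n" if t: "t \<in> I" for t
    proof -
      obtain m where "m \<in> carrier M" "\<chi> t = t \<odot>\<^bsub>M\<^esub> m"
        using M.ZsetD(4)[OF \<chi> t] by blast
      then show ?thesis
        using t f_smult f_closed M.I_carrier by auto
    qed
  qed (use M.Zset_closed[OF \<chi>] M.ZsetD(2,3)[OF \<chi>] M.I_add_closed M.I_mult_closed f_closed f_add f_smult
      in auto)
  show "(\<lambda>t\<in>I. f (\<phi> t)) \<in> Zset R I N"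
    using comp[OF \<phi>] .
  define \<psi> where "\<psi> = (SOME \<psi>. \<psi> \<in> Hclass R I M \<phi>)"
  have \<psi>: "\<psi> \<in> Zset R I M" "cohomologous I M \<phi> \<psi>"
    using M.some_Hclass[OF \<phi>] unfolding \<psi>_def by auto
  then obtain m where m: "m \<in> carrier M" "\<forall>t\<in>I. \<psi> t = \<phi> t \<oplus>\<^bsub>M\<^esub> t \<odot>\<^bsub>M\<^esub> m"
    unfolding cohomologous_def by auto
  have "\<forall>t\<in>I. f (\<psi> t) = f (\<phi> t) \<oplus>\<^bsub>N\<^esub> t \<odot>\<^bsub>N\<^esub> f m"
    using m f_add f_smult M.Zset_closed[OF \<phi>] M.I_carrier by simp
  then have "cohomologous I N (\<lambda>t\<in>I. f (\<phi> t)) (\<lambda>t\<in>I. f (\<psi> t))"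
    unfolding cohomologous_def using f_closed[OF m(1)] by auto
  then show "Hmap R I N f (Hclass R I M \<phi>) = Hclass R I N (\<lambda>t\<in>I. f (\<phi> t))"
    using N.Hclass_eq_iff[OF comp[OF \<psi>(1)] comp[OF \<phi>]] N.cohomologous_sym[OF comp[OF \<phi>]]
    unfolding Hmap_def \<psi>_def[symmetric] by simp
qed

section \<open>Products and direct sums\<close>

lemma prod_mod_simps:
  "carrier (prod_mod R \<Lambda> Ms) = Pi\<^sub>E \<Lambda> (\<lambda>l. carrier (Ms l))"
  "\<zero>\<^bsub>prod_mod R \<Lambda> Ms\<^esub> = (\<lambda>l\<in>\<Lambda>. \<zero>\<^bsub>Ms l\<^esub>)"
  "x \<oplus>\<^bsub>prod_mod R \<Lambda> Ms\<^esub> y = (\<lambda>l\<in>\<Lambda>. x l \<oplus>\<^bsub>Ms l\<^esub> y l)"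
  "r \<odot>\<^bsub>prod_mod R \<Lambda> Ms\<^esub> x = (\<lambda>l\<in>\<Lambda>. r \<odot>\<^bsub>Ms l\<^esub> x l)"
  unfolding prod_mod_def by simp_all

lemma dsum_mod_simps:
  "carrier (dsum_mod R \<Lambda> Ms) = {x \<in> Pi\<^sub>E \<Lambda> (\<lambda>l. carrier (Ms l)). finite {l\<in>\<Lambda>. x l \<noteq> \<zero>\<^bsub>Ms l\<^esub>}}"
  "\<zero>\<^bsub>dsum_mod R \<Lambda> Ms\<^esub> = (\<lambda>l\<in>\<Lambda>. \<zero>\<^bsub>Ms l\<^esub>)"
  "x \<oplus>\<^bsub>dsum_mod R \<Lambda> Ms\<^esub> y = (\<lambda>l\<in>\<Lambda>. x l \<oplus>\<^bsub>Ms l\<^esub> y l)"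
  "r \<odot>\<^bsub>dsum_mod R \<Lambda> Ms\<^esub> x = (\<lambda>l\<in>\<Lambda>. r \<odot>\<^bsub>Ms l\<^esub> x l)"
  unfolding dsum_mod_def by simp_all

lemma dsum_mod_eq_prod_mod:
  "dsum_mod R \<Lambda> Ms = (prod_mod R \<Lambda> Ms)\<lparr>carrier := carrier (dsum_mod R \<Lambda> Ms)\<rparr>"
  unfolding dsum_mod_def prod_mod_def by simp

lemma prod_module:
  assumes R: "cring R" and Ms: "\<And>l. l \<in> \<Lambda> \<Longrightarrow> module R (Ms l)"
  shows "module R (prod_mod R \<Lambda> Ms)"
proof -
  note ag = module.axioms(2)[OF Ms]
  note am = abelian_group.axioms(1)[OF ag]
  note facts = abelian_monoid.a_closed[OF am] abelian_monoid.zero_closed[OF am]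
    abelian_monoid.a_assoc[OF am] abelian_monoid.a_comm[OF am] abelian_monoid.l_zero[OF am]
    abelian_group.a_inv_closed[OF ag] abelian_group.l_neg[OF ag]
    module.smult_closed[OF Ms] module.smult_l_distr[OF Ms] module.smult_r_distr[OF Ms]
    module.smult_assoc1[OF Ms] module.smult_one[OF Ms]
  have "abelian_group (prod_mod R \<Lambda> Ms)"
  proof (rule abelian_groupI)
    fix x assume x: "x \<in> carrier (prod_mod R \<Lambda> Ms)"
    show "\<zero>\<^bsub>prod_mod R \<Lambda> Ms\<^esub> \<oplus>\<^bsub>prod_mod R \<Lambda> Ms\<^esub> x = x"
      using x facts unfolding prod_mod_simps by (auto simp: PiE_iff extensional_def fun_eq_iff)
    show "\<exists>y\<in>carrier (prod_mod R \<Lambda> Ms). y \<oplus>\<^bsub>prod_mod R \<Lambda> Ms\<^esub> x = \<zero>\<^bsub>prod_mod R \<Lambda> Ms\<^esub>"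
      using x facts unfolding prod_mod_simps
      by (auto simp: PiE_iff intro!: bexI[of _ "\<lambda>l\<in>\<Lambda>. \<ominus>\<^bsub>Ms l\<^esub> x l"] restrict_ext)
  qed (use facts in \<open>auto simp: prod_mod_simps PiE_iff intro!: restrict_ext\<close>)
  then show ?thesis
  proof (rule moduleI[OF R])
    fix x assume x: "x \<in> carrier (prod_mod R \<Lambda> Ms)"
    show "\<one>\<^bsub>R\<^esub> \<odot>\<^bsub>prod_mod R \<Lambda> Ms\<^esub> x = x"
      using x facts unfolding prod_mod_simps by (auto simp: PiE_iff extensional_def fun_eq_iff)
  qed (use facts in \<open>auto simp: prod_mod_simps PiE_iff intro!: restrict_ext\<close>)
qed

lemma dsum_carrier_truncation:
  assumes Ms: "\<And>l. l \<in> \<Lambda> \<Longrightarrow> module R (Ms l)" and "finite F"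
    and m: "\<And>l. l \<in> F \<Longrightarrow> l \<in> \<Lambda> \<Longrightarrow> m l \<in> carrier (Ms l)"
  shows "(\<lambda>l\<in>\<Lambda>. if l \<in> F then m l else \<zero>\<^bsub>Ms l\<^esub>) \<in> carrier (dsum_mod R \<Lambda> Ms)"
proof -
  have "{l\<in>\<Lambda>. (if l \<in> F then m l else \<zero>\<^bsub>Ms l\<^esub>) \<noteq> \<zero>\<^bsub>Ms l\<^esub>} \<subseteq> F"
    by auto
  then show ?thesis
    unfolding dsum_mod_simps
    using assms abelian_monoid.zero_closed[OF abelian_group.axioms(1)[OF module.axioms(2)[OF Ms]]]
    by (auto intro: finite_subset)
qed

lemma dsum_module:
  assumes R: "cring R" and Ms: "\<And>l. l \<in> \<Lambda> \<Longrightarrow> module R (Ms l)"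
  shows "module R (dsum_mod R \<Lambda> Ms)"
proof -
  interpret P: module R "prod_mod R \<Lambda> Ms"
    using prod_module[OF R Ms] .
  let ?supp = "\<lambda>x. {l\<in>\<Lambda>. x l \<noteq> \<zero>\<^bsub>Ms l\<^esub>}"
  have smult_supp: "?supp (r \<odot>\<^bsub>prod_mod R \<Lambda> Ms\<^esub> x) \<subseteq> ?supp x" if "r \<in> carrier R" for r x
    using module.smult_r_null[OF Ms] that unfolding prod_mod_simps by auto
  have "submodule (carrier (dsum_mod R \<Lambda> Ms)) R (prod_mod R \<Lambda> Ms)"
  proof (rule P.submoduleI)
    show "carrier (dsum_mod R \<Lambda> Ms) \<subseteq> carrier (prod_mod R \<Lambda> Ms)"
      unfolding prod_mod_simps dsum_mod_simps by auto
    show "\<zero>\<^bsub>prod_mod R \<Lambda> Ms\<^esub> \<in> carrier (dsum_mod R \<Lambda> Ms)"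
      using P.zero_closed unfolding prod_mod_simps dsum_mod_simps by auto
  next
    fix a x assume a: "a \<in> carrier R" and x: "x \<in> carrier (dsum_mod R \<Lambda> Ms)"
    then show "a \<odot>\<^bsub>prod_mod R \<Lambda> Ms\<^esub> x \<in> carrier (dsum_mod R \<Lambda> Ms)"
      using P.smult_closed[OF a] smult_supp[OF a, of x] unfolding dsum_mod_simps prod_mod_simps(1)
      by (auto intro: finite_subset)
  next
    fix x assume x: "x \<in> carrier (dsum_mod R \<Lambda> Ms)"
    have "\<ominus>\<^bsub>prod_mod R \<Lambda> Ms\<^esub> x = (\<ominus>\<^bsub>R\<^esub> \<one>\<^bsub>R\<^esub>) \<odot>\<^bsub>prod_mod R \<Lambda> Ms\<^esub> x"
      using P.smult_l_minus[of "\<one>\<^bsub>R\<^esub>" x] P.smult_one[of x] x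
      unfolding dsum_mod_simps prod_mod_simps(1) by simp
    then show "\<ominus>\<^bsub>prod_mod R \<Lambda> Ms\<^esub> x \<in> carrier (dsum_mod R \<Lambda> Ms)"
      using P.smult_closed[of "\<ominus>\<^bsub>R\<^esub> \<one>\<^bsub>R\<^esub>" x] smult_supp[of "\<ominus>\<^bsub>R\<^esub> \<one>\<^bsub>R\<^esub>" x] x
      unfolding dsum_mod_simps prod_mod_simps(1) by (auto intro: finite_subset)
  next
    fix x y assume x: "x \<in> carrier (dsum_mod R \<Lambda> Ms)" and y: "y \<in> carrier (dsum_mod R \<Lambda> Ms)"
    have "?supp (x \<oplus>\<^bsub>prod_mod R \<Lambda> Ms\<^esub> y) \<subseteq> ?supp x \<union> ?supp y"
      using x y abelian_monoid.l_zero[OF abelian_group.axioms(1)[OF module.axioms(2)[OF Ms]]]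
      unfolding dsum_mod_simps prod_mod_simps by (auto simp: PiE_iff)
    then show "x \<oplus>\<^bsub>prod_mod R \<Lambda> Ms\<^esub> y \<in> carrier (dsum_mod R \<Lambda> Ms)"
      using x y P.a_closed unfolding dsum_mod_simps prod_mod_simps(1) by (auto intro: finite_subset)
  qed
  then show ?thesis
    by (subst dsum_mod_eq_prod_mod) (rule submodule.submodule_is_module[OF _ P.module_axioms])
qed

locale componentwise_module =
  fixes R :: "('a, 'c) ring_scheme" and I :: "'a set" and \<Lambda> :: "'l set"
    and Ms :: "'l \<Rightarrow> ('a, 'b, 'd) module_scheme" and A :: "('a, 'l \<Rightarrow> 'b) module"
  assumes A: "module_ideal R A I" and Ms: "\<And>l. l \<in> \<Lambda> \<Longrightarrow> module_ideal R (Ms l) I"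
    and carrier_A: "carrier A \<subseteq> Pi\<^sub>E \<Lambda> (\<lambda>l. carrier (Ms l))"
    and add_A: "\<And>x y. x \<oplus>\<^bsub>A\<^esub> y = (\<lambda>l\<in>\<Lambda>. x l \<oplus>\<^bsub>Ms l\<^esub> y l)"
    and smult_A: "\<And>r x. r \<odot>\<^bsub>A\<^esub> x = (\<lambda>l\<in>\<Lambda>. r \<odot>\<^bsub>Ms l\<^esub> x l)"
begin

sublocale A: module_ideal R A I
  by (rule A)

lemma projection_mod_hom: "l \<in> \<Lambda> \<Longrightarrow> is_mod_hom R A (Ms l) (\<lambda>x. x l)"
  using carrier_A unfolding is_mod_hom_def add_A smult_A by auto

lemma component_Zset: "\<phi> \<in> Zset R I A \<Longrightarrow> l \<in> \<Lambda> \<Longrightarrow> (\<lambda>t\<in>I. \<phi> t l) \<in> Zset R I (Ms l)"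
  using Hmap_Hclass(1)[OF A Ms projection_mod_hom] by blast

lemma can_prod_Hclass:
  "\<phi> \<in> Zset R I A \<Longrightarrow> can_prod R I \<Lambda> Ms (Hclass R I A \<phi>) = (\<lambda>l\<in>\<Lambda>. Hclass R I (Ms l) (\<lambda>t\<in>I. \<phi> t l))"
  unfolding can_prod_def using Hmap_Hclass(2)[OF A Ms projection_mod_hom] by (auto intro!: restrict_ext)

lemma can_prod_add:
  assumes x: "x \<in> carrier (Hmod R I A)" and y: "y \<in> carrier (Hmod R I A)"
  shows "can_prod R I \<Lambda> Ms (x \<oplus>\<^bsub>Hmod R I A\<^esub> y)
    = (\<lambda>l\<in>\<Lambda>. can_prod R I \<Lambda> Ms x l \<oplus>\<^bsub>Hmod R I (Ms l)\<^esub> can_prod R I \<Lambda> Ms y l)"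
proof -
  obtain \<phi> where \<phi>: "\<phi> \<in> Zset R I A" "x = Hclass R I A \<phi>"
    using x by (rule HmodE)
  obtain \<psi> where \<psi>: "\<psi> \<in> Zset R I A" "y = Hclass R I A \<psi>"
    using y by (rule HmodE)
  have "(\<lambda>t\<in>I. hadd I A \<phi> \<psi> t l) = hadd I (Ms l) (\<lambda>t\<in>I. \<phi> t l) (\<lambda>t\<in>I. \<psi> t l)"
    if "l \<in> \<Lambda>" for l
    using that by (auto simp: hadd_def add_A intro!: restrict_ext)
  then show ?thesis
    unfolding \<phi>(2) \<psi>(2) A.Hmod_add[OF \<phi>(1) \<psi>(1)] can_prod_Hclass[OF A.hadd_Zset[OF \<phi>(1) \<psi>(1)]]
      can_prod_Hclass[OF \<phi>(1)] can_prod_Hclass[OF \<psi>(1)]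
    using module_ideal.Hmod_add[OF Ms component_Zset[OF \<phi>(1)] component_Zset[OF \<psi>(1)]]
    by (auto intro!: restrict_ext)
qed

lemma can_prod_smult:
  assumes r: "r \<in> carrier R" and x: "x \<in> carrier (Hmod R I A)"
  shows "can_prod R I \<Lambda> Ms (r \<odot>\<^bsub>Hmod R I A\<^esub> x) = (\<lambda>l\<in>\<Lambda>. r \<odot>\<^bsub>Hmod R I (Ms l)\<^esub> can_prod R I \<Lambda> Ms x l)"
proof -
  obtain \<phi> where \<phi>: "\<phi> \<in> Zset R I A" "x = Hclass R I A \<phi>"
    using x by (rule HmodE)
  have "(\<lambda>t\<in>I. hsmult I A r \<phi> t l) = hsmult I (Ms l) r (\<lambda>t\<in>I. \<phi> t l)" if "l \<in> \<Lambda>" for l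
    using that by (auto simp: hsmult_def smult_A intro!: restrict_ext)
  then show ?thesis
    unfolding \<phi>(2) A.Hmod_smult[OF r \<phi>(1)] can_prod_Hclass[OF A.hsmult_Zset[OF r \<phi>(1)]]
      can_prod_Hclass[OF \<phi>(1)]
    using module_ideal.Hmod_smult[OF Ms r component_Zset[OF \<phi>(1)]]
    by (auto intro!: restrict_ext)
qed

lemma can_prod_eq_iff:
  assumes \<phi>: "\<phi> \<in> Zset R I A" and \<psi>: "\<psi> \<in> Zset R I A"
  shows "can_prod R I \<Lambda> Ms (Hclass R I A \<phi>) = can_prod R I \<Lambda> Ms (Hclass R I A \<psi>)
    \<longleftrightarrow> (\<forall>l\<in>\<Lambda>. \<exists>m\<in>carrier (Ms l). \<forall>t\<in>I. \<psi> t l = \<phi> t l \<oplus>\<^bsub>Ms l\<^esub> t \<odot>\<^bsub>Ms l\<^esub> m)"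
proof -
  have restrict_eq_iff: "(\<lambda>l\<in>\<Lambda>. a l) = (\<lambda>l\<in>\<Lambda>. b l) \<longleftrightarrow> (\<forall>l\<in>\<Lambda>. a l = b l)" for a b :: "'l \<Rightarrow> 'x"
    by (metis restrict_apply' restrict_ext)
  show ?thesis
    unfolding can_prod_Hclass[OF \<phi>] can_prod_Hclass[OF \<psi>] restrict_eq_iff
    using module_ideal.Hclass_eq_iff[OF Ms component_Zset[OF \<phi>] component_Zset[OF \<psi>]]
    unfolding cohomologous_def by simp
qed

lemma cohomologous_componentwiseI:
  assumes \<psi>: "\<psi> \<in> Zset R I A" and m: "m \<in> carrier A"
    and eq: "\<And>l t. l \<in> \<Lambda> \<Longrightarrow> t \<in> I \<Longrightarrow> \<psi> t l = \<phi> t l \<oplus>\<^bsub>Ms l\<^esub> t \<odot>\<^bsub>Ms l\<^esub> m l"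
  shows "cohomologous I A \<phi> \<psi>"
proof -
  have "\<psi> t = \<phi> t \<oplus>\<^bsub>A\<^esub> t \<odot>\<^bsub>A\<^esub> m" if t: "t \<in> I" for t
  proof
    fix l
    have "\<psi> t \<in> extensional \<Lambda>"
      using A.Zset_closed[OF \<psi> t] carrier_A by (auto simp: PiE_iff)
    then show "\<psi> t l = (\<phi> t \<oplus>\<^bsub>A\<^esub> t \<odot>\<^bsub>A\<^esub> m) l"
      using eq[OF _ t] unfolding add_A smult_A by (cases "l \<in> \<Lambda>") (auto simp: extensional_def)
  qed
  then show ?thesis
    unfolding cohomologous_def using m by blast
qed

lemma glue_Zset:
  assumes \<Phi>: "\<And>l. l \<in> \<Lambda> \<Longrightarrow> \<Phi> l \<in> Zset R I (Ms l)"
    and closed: "\<And>t. t \<in> I \<Longrightarrow> (\<lambda>l\<in>\<Lambda>. \<Phi> l t) \<in> carrier A"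
    and principal: "\<And>t. t \<in> I \<Longrightarrow> \<exists>m\<in>carrier A. \<forall>l\<in>\<Lambda>. \<Phi> l t = t \<odot>\<^bsub>Ms l\<^esub> m l"
  shows "(\<lambda>t\<in>I. \<lambda>l\<in>\<Lambda>. \<Phi> l t) \<in> Zset R I A"
    and "can_prod R I \<Lambda> Ms (Hclass R I A (\<lambda>t\<in>I. \<lambda>l\<in>\<Lambda>. \<Phi> l t)) = (\<lambda>l\<in>\<Lambda>. Hclass R I (Ms l) (\<Phi> l))"
proof -
  show glued: "(\<lambda>t\<in>I. \<lambda>l\<in>\<Lambda>. \<Phi> l t) \<in> Zset R I A"
  proof (rule A.ZsetI)
    show "\<exists>m\<in>carrier A. (\<lambda>t\<in>I. \<lambda>l\<in>\<Lambda>. \<Phi> l t) t = t \<odot>\<^bsub>A\<^esub> m" if "t \<in> I" for t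
      using principal[OF that] that unfolding smult_A by (auto intro: restrict_ext)
  qed (use closed module_ideal.ZsetD(2,3)[OF Ms \<Phi>] A.I_add_closed A.I_mult_closed in
      \<open>auto simp: add_A smult_A intro!: restrict_ext\<close>)
  have "(\<lambda>t\<in>I. (\<lambda>t\<in>I. \<lambda>l\<in>\<Lambda>. \<Phi> l t) t l) = \<Phi> l" if "l \<in> \<Lambda>" for l
    using module_ideal.Zset_undefined[OF Ms[OF that] \<Phi>[OF that]] that by auto
  then show "can_prod R I \<Lambda> Ms (Hclass R I A (\<lambda>t\<in>I. \<lambda>l\<in>\<Lambda>. \<Phi> l t)) = (\<lambda>l\<in>\<Lambda>. Hclass R I (Ms l) (\<Phi> l))"
    unfolding can_prod_Hclass[OF glued] by (auto intro!: restrict_ext)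
qed

lemma glued_Hclass_in_image:
  assumes "\<And>l. l \<in> \<Lambda> \<Longrightarrow> \<Phi> l \<in> Zset R I (Ms l)"
    and "\<And>t. t \<in> I \<Longrightarrow> (\<lambda>l\<in>\<Lambda>. \<Phi> l t) \<in> carrier A"
    and "\<And>t. t \<in> I \<Longrightarrow> \<exists>m\<in>carrier A. \<forall>l\<in>\<Lambda>. \<Phi> l t = t \<odot>\<^bsub>Ms l\<^esub> m l"
  shows "(\<lambda>l\<in>\<Lambda>. Hclass R I (Ms l) (\<Phi> l)) \<in> can_prod R I \<Lambda> Ms ` carrier (Hmod R I A)"
proof -
  have Z: "(\<lambda>t\<in>I. \<lambda>l\<in>\<Lambda>. \<Phi> l t) \<in> Zset R I A"
    by (intro glue_Zset(1) assms)
  have "(\<lambda>l\<in>\<Lambda>. Hclass R I (Ms l) (\<Phi> l)) = can_prod R I \<Lambda> Ms (Hclass R I A (\<lambda>t\<in>I. \<lambda>l\<in>\<Lambda>. \<Phi> l t))"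
    by (intro glue_Zset(2)[symmetric] assms)
  then show ?thesis
    using Hclass_in_Hmod[OF Z] by (rule image_eqI)
qed

lemma can_prod_is_mod_iso:
  assumes add_T: "\<And>x y. x \<oplus>\<^bsub>T\<^esub> y = (\<lambda>l\<in>\<Lambda>. x l \<oplus>\<^bsub>Hmod R I (Ms l)\<^esub> y l)"
    and smult_T: "\<And>r x. r \<odot>\<^bsub>T\<^esub> x = (\<lambda>l\<in>\<Lambda>. r \<odot>\<^bsub>Hmod R I (Ms l)\<^esub> x l)"
    and into: "\<And>x. x \<in> carrier (Hmod R I A) \<Longrightarrow> can_prod R I \<Lambda> Ms x \<in> carrier T"
    and inj: "inj_on (can_prod R I \<Lambda> Ms) (carrier (Hmod R I A))"
    and onto: "carrier T \<subseteq> can_prod R I \<Lambda> Ms ` carrier (Hmod R I A)"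
  shows "is_mod_iso R (Hmod R I A) T (can_prod R I \<Lambda> Ms)"
  unfolding is_mod_iso_def is_mod_hom_def bij_betw_def add_T smult_T
  using into inj onto can_prod_add can_prod_smult by auto

end

context
  fixes R :: "('a, 'c) ring_scheme" and I :: "'a set" and \<Lambda> :: "'l set"
    and Ms :: "'l \<Rightarrow> ('a, 'b, 'd) module_scheme"
  assumes R_cring: "cring R" and I_ideal: "ideal I R" and Ms_module: "\<And>l. l \<in> \<Lambda> \<Longrightarrow> module R (Ms l)"
begin

lemma Ms_module_ideal: "l \<in> \<Lambda> \<Longrightarrow> module_ideal R (Ms l) I"
  using module_idealI[OF R_cring I_ideal Ms_module] .

lemma componentwise_module_prod: "componentwise_module R I \<Lambda> Ms (prod_mod R \<Lambda> Ms)"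
  unfolding componentwise_module_def prod_mod_simps
  using module_idealI[OF R_cring I_ideal prod_module[OF R_cring Ms_module]] Ms_module_ideal by auto

lemma componentwise_module_dsum: "componentwise_module R I \<Lambda> Ms (dsum_mod R \<Lambda> Ms)"
  unfolding componentwise_module_def dsum_mod_simps
  using module_idealI[OF R_cring I_ideal dsum_module[OF R_cring Ms_module]] Ms_module_ideal by auto

lemma can_prod_prod_inj: "inj_on (can_prod R I \<Lambda> Ms) (carrier (Hmod R I (prod_mod R \<Lambda> Ms)))"
proof (rule inj_onI)
  interpret componentwise_module R I \<Lambda> Ms "prod_mod R \<Lambda> Ms"
    by (rule componentwise_module_prod)
  fix x y assume x: "x \<in> carrier (Hmod R I (prod_mod R \<Lambda> Ms))"
    and y: "y \<in> carrier (Hmod R I (prod_mod R \<Lambda> Ms))"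
    and eq: "can_prod R I \<Lambda> Ms x = can_prod R I \<Lambda> Ms y"
  obtain \<phi> where \<phi>: "\<phi> \<in> Zset R I (prod_mod R \<Lambda> Ms)" "x = Hclass R I (prod_mod R \<Lambda> Ms) \<phi>"
    using x by (rule HmodE)
  obtain \<psi> where \<psi>: "\<psi> \<in> Zset R I (prod_mod R \<Lambda> Ms)" "y = Hclass R I (prod_mod R \<Lambda> Ms) \<psi>"
    using y by (rule HmodE)
  have "\<forall>l\<in>\<Lambda>. \<exists>m. m \<in> carrier (Ms l) \<and> (\<forall>t\<in>I. \<psi> t l = \<phi> t l \<oplus>\<^bsub>Ms l\<^esub> t \<odot>\<^bsub>Ms l\<^esub> m)"
    using eq unfolding \<phi>(2) \<psi>(2) can_prod_eq_iff[OF \<phi>(1) \<psi>(1)] by blast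
  then obtain m where m: "\<forall>l\<in>\<Lambda>. m l \<in> carrier (Ms l) \<and> (\<forall>t\<in>I. \<psi> t l = \<phi> t l \<oplus>\<^bsub>Ms l\<^esub> t \<odot>\<^bsub>Ms l\<^esub> m l)"
    by (rule bchoice[elim_format]) blast
  have "cohomologous I (prod_mod R \<Lambda> Ms) \<phi> \<psi>"
    by (rule cohomologous_componentwiseI[OF \<psi>(1), of "restrict m \<Lambda>"])
      (use m in \<open>auto simp: prod_mod_simps\<close>)
  then show "x = y"
    unfolding \<phi>(2) \<psi>(2) using A.Hclass_eq_iff[OF \<phi>(1) \<psi>(1)] by simp
qed

lemma prod_glued_Hclass_in_image:
  assumes \<Phi>: "\<And>l. l \<in> \<Lambda> \<Longrightarrow> \<Phi> l \<in> Zset R I (Ms l)"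
  shows "(\<lambda>l\<in>\<Lambda>. Hclass R I (Ms l) (\<Phi> l)) \<in> can_prod R I \<Lambda> Ms ` carrier (Hmod R I (prod_mod R \<Lambda> Ms))"
proof -
  interpret componentwise_module R I \<Lambda> Ms "prod_mod R \<Lambda> Ms"
    by (rule componentwise_module_prod)
  have principal: "\<exists>m\<in>carrier (prod_mod R \<Lambda> Ms). \<forall>l\<in>\<Lambda>. \<Phi> l t = t \<odot>\<^bsub>Ms l\<^esub> m l" if t: "t \<in> I" for t
  proof -
    have "\<forall>l\<in>\<Lambda>. \<exists>m. m \<in> carrier (Ms l) \<and> \<Phi> l t = t \<odot>\<^bsub>Ms l\<^esub> m"
      using module_ideal.ZsetD(4)[OF Ms \<Phi> t] by blast
    then obtain m where "\<forall>l\<in>\<Lambda>. m l \<in> carrier (Ms l) \<and> \<Phi> l t = t \<odot>\<^bsub>Ms l\<^esub> m l"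
      by (rule bchoice[elim_format]) blast
    then show ?thesis
      by (intro bexI[of _ "restrict m \<Lambda>"]) (auto simp: prod_mod_simps)
  qed
  have closed: "(\<lambda>l\<in>\<Lambda>. \<Phi> l t) \<in> carrier (prod_mod R \<Lambda> Ms)" if "t \<in> I" for t
    using module_ideal.Zset_closed[OF Ms \<Phi> that] unfolding prod_mod_simps by auto
  show ?thesis
    by (rule glued_Hclass_in_image[of \<Phi>, OF \<Phi> closed principal])
qed

lemma can_prod_prod_onto:
  "carrier (prod_mod R \<Lambda> (\<lambda>l. Hmod R I (Ms l))) \<subseteq> can_prod R I \<Lambda> Ms ` carrier (Hmod R I (prod_mod R \<Lambda> Ms))"
proof
  fix x assume x: "x \<in> carrier (prod_mod R \<Lambda> (\<lambda>l. Hmod R I (Ms l)))"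
  then have "\<forall>l\<in>\<Lambda>. \<exists>\<phi>. \<phi> \<in> Zset R I (Ms l) \<and> x l = Hclass R I (Ms l) \<phi>"
    unfolding prod_mod_simps Hmod_carrier by auto
  then obtain \<Phi> where \<Phi>: "\<forall>l\<in>\<Lambda>. \<Phi> l \<in> Zset R I (Ms l) \<and> x l = Hclass R I (Ms l) (\<Phi> l)"
    by (rule bchoice[elim_format]) blast
  have "x = (\<lambda>l\<in>\<Lambda>. x l)"
    using x unfolding prod_mod_simps by (simp add: PiE_restrict)
  also have "\<dots> = (\<lambda>l\<in>\<Lambda>. Hclass R I (Ms l) (\<Phi> l))"
    by (rule restrict_ext) (use \<Phi> in blast)
  moreover have "\<And>l. l \<in> \<Lambda> \<Longrightarrow> \<Phi> l \<in> Zset R I (Ms l)"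
    using \<Phi> by blast
  ultimately show "x \<in> can_prod R I \<Lambda> Ms ` carrier (Hmod R I (prod_mod R \<Lambda> Ms))"
    using prod_glued_Hclass_in_image[of \<Phi>] by simp
qed

lemma Hmod_prod_iso:
  "is_mod_iso R (Hmod R I (prod_mod R \<Lambda> Ms)) (prod_mod R \<Lambda> (\<lambda>l. Hmod R I (Ms l))) (can_prod R I \<Lambda> Ms)"
proof -
  interpret componentwise_module R I \<Lambda> Ms "prod_mod R \<Lambda> Ms"
    by (rule componentwise_module_prod)
  have closed: "can_prod R I \<Lambda> Ms x \<in> carrier (prod_mod R \<Lambda> (\<lambda>l. Hmod R I (Ms l)))"
    if x: "x \<in> carrier (Hmod R I (prod_mod R \<Lambda> Ms))" for x
  proof -
    obtain \<phi> where \<phi>: "\<phi> \<in> Zset R I (prod_mod R \<Lambda> Ms)" "x = Hclass R I (prod_mod R \<Lambda> Ms) \<phi>"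
      using x by (rule HmodE)
    show ?thesis
      unfolding \<phi>(2) can_prod_Hclass[OF \<phi>(1)] prod_mod_simps
      using Hclass_in_Hmod[OF component_Zset[OF \<phi>(1)]] by auto
  qed
  show ?thesis
    by (rule can_prod_is_mod_iso[OF _ _ closed can_prod_prod_inj can_prod_prod_onto])
      (simp_all add: prod_mod_simps)
qed

lemma dsum_Zset_support:
  assumes fg: "fin_gen_ideal R I" and \<phi>: "\<phi> \<in> Zset R I (dsum_mod R \<Lambda> Ms)"
  shows "\<exists>F. finite F \<and> (\<forall>l\<in>\<Lambda>. l \<notin> F \<longrightarrow> (\<forall>t\<in>I. \<phi> t l = \<zero>\<^bsub>Ms l\<^esub>))"
proof -
  interpret componentwise_module R I \<Lambda> Ms "dsum_mod R \<Lambda> Ms"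
    by (rule componentwise_module_dsum)
  obtain G where G: "finite G" "G \<subseteq> carrier R" "I = Idl\<^bsub>R\<^esub> G"
    using fg unfolding fin_gen_ideal_def by auto
  have GI: "G \<subseteq> I"
    using G(2,3) A.genideal_self by blast
  define F where "F = (\<Union>g\<in>G. {l\<in>\<Lambda>. \<phi> g l \<noteq> \<zero>\<^bsub>Ms l\<^esub>})"
  have "finite F"
    unfolding F_def using G(1) GI A.Zset_closed[OF \<phi>] unfolding dsum_mod_simps by auto
  moreover have "\<phi> t l = \<zero>\<^bsub>Ms l\<^esub>" if l: "l \<in> \<Lambda>" "l \<notin> F" and t: "t \<in> I" for l t
  proof -
    interpret Ml: module_ideal R "Ms l" I
      using Ms[OF l(1)] .
    have "(\<lambda>t\<in>I. \<phi> t l) \<in> hom_lin R (Idl\<^bsub>R\<^esub> G) (Ms l)" "(\<lambda>t\<in>I. \<zero>\<^bsub>Ms l\<^esub>) \<in> hom_lin R (Idl\<^bsub>R\<^esub> G) (Ms l)"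
      using component_Zset[OF \<phi> l(1)] Ml.zero_map_Zset Zset_subset_hom_lin G(3) by blast+
    moreover have "(\<lambda>t\<in>I. \<phi> t l) g = (\<lambda>t\<in>I. \<zero>\<^bsub>Ms l\<^esub>) g" if "g \<in> G" for g
      using that l GI unfolding F_def by auto
    ultimately have "(\<lambda>t\<in>I. \<phi> t l) t = (\<lambda>t\<in>I. \<zero>\<^bsub>Ms l\<^esub>) t"
      using Ml.hom_lin_eq_on_generators[OF G(2)] t G(3) by blast
    then show ?thesis
      using t by simp
  qed
  ultimately show ?thesis
    by blast
qed

lemma component_zero_simps:
  assumes "l \<in> \<Lambda>"
  shows "t \<in> I \<Longrightarrow> t \<odot>\<^bsub>Ms l\<^esub> \<zero>\<^bsub>Ms l\<^esub> = \<zero>\<^bsub>Ms l\<^esub>"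
    and "\<zero>\<^bsub>Ms l\<^esub> \<oplus>\<^bsub>Ms l\<^esub> \<zero>\<^bsub>Ms l\<^esub> = \<zero>\<^bsub>Ms l\<^esub>"
proof -
  interpret module R "Ms l"
    using Ms_module[OF assms] .
  show "t \<in> I \<Longrightarrow> t \<odot>\<^bsub>Ms l\<^esub> \<zero>\<^bsub>Ms l\<^esub> = \<zero>\<^bsub>Ms l\<^esub>"
    using ideal.Icarr[OF I_ideal] by simp
  show "\<zero>\<^bsub>Ms l\<^esub> \<oplus>\<^bsub>Ms l\<^esub> \<zero>\<^bsub>Ms l\<^esub> = \<zero>\<^bsub>Ms l\<^esub>"
    by simp
qed

lemma can_prod_dsum_closed:
  assumes fg: "fin_gen_ideal R I" and x: "x \<in> carrier (Hmod R I (dsum_mod R \<Lambda> Ms))"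
  shows "can_prod R I \<Lambda> Ms x \<in> carrier (dsum_mod R \<Lambda> (\<lambda>l. Hmod R I (Ms l)))"
proof -
  interpret componentwise_module R I \<Lambda> Ms "dsum_mod R \<Lambda> Ms"
    by (rule componentwise_module_dsum)
  obtain \<phi> where \<phi>: "\<phi> \<in> Zset R I (dsum_mod R \<Lambda> Ms)" "x = Hclass R I (dsum_mod R \<Lambda> Ms) \<phi>"
    using x by (rule HmodE)
  obtain F where F: "finite F" "\<And>l t. l \<in> \<Lambda> \<Longrightarrow> l \<notin> F \<Longrightarrow> t \<in> I \<Longrightarrow> \<phi> t l = \<zero>\<^bsub>Ms l\<^esub>"
    using dsum_Zset_support[OF fg \<phi>(1)] by blast
  have "Hclass R I (Ms l) (\<lambda>t\<in>I. \<phi> t l) = \<zero>\<^bsub>Hmod R I (Ms l)\<^esub>" if "l \<in> \<Lambda>" "l \<notin> F" for l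
  proof -
    have "(\<lambda>t\<in>I. \<phi> t l) = (\<lambda>t\<in>I. \<zero>\<^bsub>Ms l\<^esub>)"
      using F(2)[OF that] by (auto intro: restrict_ext)
    then show ?thesis
      using module_ideal.Hmod_zero[OF Ms[OF that(1)]] by simp
  qed
  then have "{l\<in>\<Lambda>. can_prod R I \<Lambda> Ms x l \<noteq> \<zero>\<^bsub>Hmod R I (Ms l)\<^esub>} \<subseteq> F"
    unfolding \<phi>(2) can_prod_Hclass[OF \<phi>(1)] by auto
  then have "finite {l\<in>\<Lambda>. can_prod R I \<Lambda> Ms x l \<noteq> \<zero>\<^bsub>Hmod R I (Ms l)\<^esub>}"
    using F(1) by (rule finite_subset)
  moreover have "can_prod R I \<Lambda> Ms x \<in> (\<Pi>\<^sub>E l\<in>\<Lambda>. carrier (Hmod R I (Ms l)))"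
    unfolding \<phi>(2) can_prod_Hclass[OF \<phi>(1)] using Hclass_in_Hmod[OF component_Zset[OF \<phi>(1)]] by auto
  ultimately show ?thesis
    unfolding dsum_mod_simps by blast
qed

lemma can_prod_dsum_inj:
  assumes fg: "fin_gen_ideal R I"
  shows "inj_on (can_prod R I \<Lambda> Ms) (carrier (Hmod R I (dsum_mod R \<Lambda> Ms)))"
proof (rule inj_onI)
  interpret componentwise_module R I \<Lambda> Ms "dsum_mod R \<Lambda> Ms"
    by (rule componentwise_module_dsum)
  fix x y assume x: "x \<in> carrier (Hmod R I (dsum_mod R \<Lambda> Ms))"
    and y: "y \<in> carrier (Hmod R I (dsum_mod R \<Lambda> Ms))"
    and eq: "can_prod R I \<Lambda> Ms x = can_prod R I \<Lambda> Ms y"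
  obtain \<phi> where \<phi>: "\<phi> \<in> Zset R I (dsum_mod R \<Lambda> Ms)" "x = Hclass R I (dsum_mod R \<Lambda> Ms) \<phi>"
    using x by (rule HmodE)
  obtain \<psi> where \<psi>: "\<psi> \<in> Zset R I (dsum_mod R \<Lambda> Ms)" "y = Hclass R I (dsum_mod R \<Lambda> Ms) \<psi>"
    using y by (rule HmodE)
  obtain F1 where F1: "finite F1" "\<And>l t. l \<in> \<Lambda> \<Longrightarrow> l \<notin> F1 \<Longrightarrow> t \<in> I \<Longrightarrow> \<phi> t l = \<zero>\<^bsub>Ms l\<^esub>"
    using dsum_Zset_support[OF fg \<phi>(1)] by blast
  obtain F2 where F2: "finite F2" "\<And>l t. l \<in> \<Lambda> \<Longrightarrow> l \<notin> F2 \<Longrightarrow> t \<in> I \<Longrightarrow> \<psi> t l = \<zero>\<^bsub>Ms l\<^esub>"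
    using dsum_Zset_support[OF fg \<psi>(1)] by blast
  have "\<forall>l\<in>\<Lambda>. \<exists>m. m \<in> carrier (Ms l) \<and> (\<forall>t\<in>I. \<psi> t l = \<phi> t l \<oplus>\<^bsub>Ms l\<^esub> t \<odot>\<^bsub>Ms l\<^esub> m)"
    using eq unfolding \<phi>(2) \<psi>(2) can_prod_eq_iff[OF \<phi>(1) \<psi>(1)] by blast
  then obtain m where m: "\<forall>l\<in>\<Lambda>. m l \<in> carrier (Ms l) \<and> (\<forall>t\<in>I. \<psi> t l = \<phi> t l \<oplus>\<^bsub>Ms l\<^esub> t \<odot>\<^bsub>Ms l\<^esub> m l)"
    by (rule bchoice[elim_format]) blast
  have truncated: "(\<lambda>l\<in>\<Lambda>. if l \<in> F1 \<union> F2 then m l else \<zero>\<^bsub>Ms l\<^esub>) \<in> carrier (dsum_mod R \<Lambda> Ms)"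
    using m by (intro dsum_carrier_truncation Ms_module finite_UnI F1(1) F2(1)) auto
  have "cohomologous I (dsum_mod R \<Lambda> Ms) \<phi> \<psi>"
  proof (rule cohomologous_componentwiseI[OF \<psi>(1) truncated])
    show "\<psi> t l = \<phi> t l \<oplus>\<^bsub>Ms l\<^esub> t \<odot>\<^bsub>Ms l\<^esub> (\<lambda>l\<in>\<Lambda>. if l \<in> F1 \<union> F2 then m l else \<zero>\<^bsub>Ms l\<^esub>) l"
      if l: "l \<in> \<Lambda>" and t: "t \<in> I" for l t
    proof (cases "l \<in> F1 \<union> F2")
      case True
      then show ?thesis
        using l t m by simp
    next
      case False
      then show ?thesis
        using l t F1(2) F2(2) component_zero_simps[OF l] by simp
    qed
  qed
  then show "x = y"
    unfolding \<phi>(2) \<psi>(2) using A.Hclass_eq_iff[OF \<phi>(1) \<psi>(1)] by simp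
qed

lemma dsum_glued_Hclass_in_image:
  assumes \<Phi>: "\<And>l. l \<in> \<Lambda> \<Longrightarrow> \<Phi> l \<in> Zset R I (Ms l)" and F: "finite F"
    and zero: "\<And>l t. l \<notin> F \<Longrightarrow> t \<in> I \<Longrightarrow> \<Phi> l t = \<zero>\<^bsub>Ms l\<^esub>"
  shows "(\<lambda>l\<in>\<Lambda>. Hclass R I (Ms l) (\<Phi> l)) \<in> can_prod R I \<Lambda> Ms ` carrier (Hmod R I (dsum_mod R \<Lambda> Ms))"
proof -
  interpret componentwise_module R I \<Lambda> Ms "dsum_mod R \<Lambda> Ms"
    by (rule componentwise_module_dsum)
  have closed: "(\<lambda>l\<in>\<Lambda>. \<Phi> l t) \<in> carrier (dsum_mod R \<Lambda> Ms)" if t: "t \<in> I" for t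
  proof -
    have "(\<lambda>l\<in>\<Lambda>. \<Phi> l t) = (\<lambda>l\<in>\<Lambda>. if l \<in> F then \<Phi> l t else \<zero>\<^bsub>Ms l\<^esub>)"
      using zero[OF _ t] by (auto intro: restrict_ext)
    also have "\<dots> \<in> carrier (dsum_mod R \<Lambda> Ms)"
      using module_ideal.Zset_closed[OF Ms \<Phi> t] by (intro dsum_carrier_truncation Ms_module F) auto
    finally show ?thesis .
  qed
  have principal: "\<exists>m\<in>carrier (dsum_mod R \<Lambda> Ms). \<forall>l\<in>\<Lambda>. \<Phi> l t = t \<odot>\<^bsub>Ms l\<^esub> m l" if t: "t \<in> I" for t
  proof -
    have "\<forall>l\<in>\<Lambda>. \<exists>m. m \<in> carrier (Ms l) \<and> \<Phi> l t = t \<odot>\<^bsub>Ms l\<^esub> m"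
      using module_ideal.ZsetD(4)[OF Ms \<Phi> t] by blast
    then obtain m where m: "\<forall>l\<in>\<Lambda>. m l \<in> carrier (Ms l) \<and> \<Phi> l t = t \<odot>\<^bsub>Ms l\<^esub> m l"
      by (rule bchoice[elim_format]) blast
    have "(\<lambda>l\<in>\<Lambda>. if l \<in> F then m l else \<zero>\<^bsub>Ms l\<^esub>) \<in> carrier (dsum_mod R \<Lambda> Ms)"
      using m by (intro dsum_carrier_truncation Ms_module F) auto
    moreover have "\<forall>l\<in>\<Lambda>. \<Phi> l t = t \<odot>\<^bsub>Ms l\<^esub> (\<lambda>l\<in>\<Lambda>. if l \<in> F then m l else \<zero>\<^bsub>Ms l\<^esub>) l"
      using m zero[OF _ t] component_zero_simps(1)[OF _ t] by auto
    ultimately show ?thesis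
      by blast
  qed
  show ?thesis
    by (rule glued_Hclass_in_image[of \<Phi>, OF \<Phi> closed principal])
qed

lemma can_prod_dsum_onto:
  "carrier (dsum_mod R \<Lambda> (\<lambda>l. Hmod R I (Ms l))) \<subseteq> can_prod R I \<Lambda> Ms ` carrier (Hmod R I (dsum_mod R \<Lambda> Ms))"
proof
  fix x assume x: "x \<in> carrier (dsum_mod R \<Lambda> (\<lambda>l. Hmod R I (Ms l)))"
  define F where "F = {l\<in>\<Lambda>. x l \<noteq> \<zero>\<^bsub>Hmod R I (Ms l)\<^esub>}"
  have F: "finite F"
    using x unfolding F_def dsum_mod_simps by blast
  have "\<forall>l\<in>\<Lambda>. \<exists>\<phi>. \<phi> \<in> Zset R I (Ms l) \<and> x l = Hclass R I (Ms l) \<phi>"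
    using x unfolding dsum_mod_simps Hmod_carrier by auto
  then obtain \<Phi>0 where \<Phi>0: "\<forall>l\<in>\<Lambda>. \<Phi>0 l \<in> Zset R I (Ms l) \<and> x l = Hclass R I (Ms l) (\<Phi>0 l)"
    by (rule bchoice[elim_format]) blast
  define \<Phi> where "\<Phi> l = (if l \<in> F then \<Phi>0 l else (\<lambda>t\<in>I. \<zero>\<^bsub>Ms l\<^esub>))" for l
  have \<Phi>_Z: "\<Phi> l \<in> Zset R I (Ms l)" if "l \<in> \<Lambda>" for l
    using \<Phi>0 module_ideal.zero_map_Zset[OF Ms_module_ideal[OF that]] that unfolding \<Phi>_def by auto
  have "x \<in> (\<Pi>\<^sub>E l\<in>\<Lambda>. carrier (Hmod R I (Ms l)))"
    using x unfolding dsum_mod_simps by blast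
  then have "x = (\<lambda>l\<in>\<Lambda>. x l)"
    by (simp add: PiE_restrict)
  also have "\<dots> = (\<lambda>l\<in>\<Lambda>. Hclass R I (Ms l) (\<Phi> l))"
  proof (rule restrict_ext)
    fix l assume l: "l \<in> \<Lambda>"
    show "x l = Hclass R I (Ms l) (\<Phi> l)"
    proof (cases "l \<in> F")
      case True
      then show ?thesis
        using \<Phi>0 l unfolding \<Phi>_def by simp
    next
      case False
      then show ?thesis
        using l module_ideal.Hmod_zero[OF Ms_module_ideal[OF l]] unfolding \<Phi>_def F_def by simp
    qed
  qed
  moreover have "\<Phi> l t = \<zero>\<^bsub>Ms l\<^esub>" if "l \<notin> F" "t \<in> I" for l t
    using that unfolding \<Phi>_def by simp
  ultimately show "x \<in> can_prod R I \<Lambda> Ms ` carrier (Hmod R I (dsum_mod R \<Lambda> Ms))"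
    using dsum_glued_Hclass_in_image[of \<Phi> F, OF \<Phi>_Z F] by simp
qed

lemma Hmod_dsum_iso:
  assumes fg: "fin_gen_ideal R I"
  shows "is_mod_iso R (Hmod R I (dsum_mod R \<Lambda> Ms)) (dsum_mod R \<Lambda> (\<lambda>l. Hmod R I (Ms l))) (can_prod R I \<Lambda> Ms)"
proof -
  interpret componentwise_module R I \<Lambda> Ms "dsum_mod R \<Lambda> Ms"
    by (rule componentwise_module_dsum)
  show ?thesis
    by (rule can_prod_is_mod_iso[OF _ _ can_prod_dsum_closed[OF fg] can_prod_dsum_inj[OF fg] can_prod_dsum_onto])
      (simp_all add: dsum_mod_simps)
qed

end

section \<open>Change of rings to R/J for an ideal J annihilating M\<close>

lemma (in module) ann_mod_ideal: "ideal (ann_mod R M) R"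
proof (rule idealI[OF R.ring_axioms])
  show "subgroup (ann_mod R M) (add_monoid R)"
  proof (rule R.add.subgroupI)
    show "ann_mod R M \<subseteq> carrier R" "ann_mod R M \<noteq> {}"
      unfolding ann_mod_def by auto
  next
    fix a assume "a \<in> ann_mod R M"
    then show "\<ominus> a \<in> ann_mod R M"
      unfolding ann_mod_def by (auto simp: smult_l_minus)
  next
    fix a b assume "a \<in> ann_mod R M" "b \<in> ann_mod R M"
    then show "a \<oplus> b \<in> ann_mod R M"
      unfolding ann_mod_def by (auto simp: smult_l_distr)
  qed
next
  fix a x assume "a \<in> ann_mod R M" "x \<in> carrier R"
  then show "x \<otimes> a \<in> ann_mod R M" "a \<otimes> x \<in> ann_mod R M"
    unfolding ann_mod_def by (auto simp: smult_assoc1 m_comm)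
qed

locale annihilator_quotient = module + I: ideal I R + J: ideal J R for I J +
  assumes J_annihilates: "\<lbrakk>j \<in> J; m \<in> carrier M\<rbrakk> \<Longrightarrow> j \<odot>\<^bsub>M\<^esub> m = \<zero>\<^bsub>M\<^esub>"
begin

sublocale HM: module_ideal R M I
  using module_idealI[OF is_cring I.ideal_axioms module_axioms] .

lemma rcoset_mem_iff: "r \<in> carrier R \<Longrightarrow> x \<in> J +> r \<longleftrightarrow> (\<exists>j\<in>J. x = j \<oplus> r)"
  unfolding a_r_coset_def' by auto

lemma Quot_carrier_iff: "c \<in> carrier (R Quot J) \<longleftrightarrow> (\<exists>r\<in>carrier R. c = J +> r)"
  unfolding FactRing_def A_RCOSETS_def' by auto

lemma Quot_add: "a \<in> carrier R \<Longrightarrow> b \<in> carrier R \<Longrightarrow> (J +> a) \<oplus>\<^bsub>R Quot J\<^esub> (J +> b) = J +> (a \<oplus> b)"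
  unfolding FactRing_def using J.a_rcos_sum by simp

lemma Quot_mult: "a \<in> carrier R \<Longrightarrow> b \<in> carrier R \<Longrightarrow> (J +> a) \<otimes>\<^bsub>R Quot J\<^esub> (J +> b) = J +> (a \<otimes> b)"
  unfolding FactRing_def using J.rcoset_mult_add by simp

lemma Quot_one: "\<one>\<^bsub>R Quot J\<^esub> = J +> \<one>"
  unfolding FactRing_def by simp

lemma quot_mod_simps:
  "carrier (quot_mod R J M) = carrier M"
  "x \<oplus>\<^bsub>quot_mod R J M\<^esub> y = x \<oplus>\<^bsub>M\<^esub> y"
  "\<zero>\<^bsub>quot_mod R J M\<^esub> = \<zero>\<^bsub>M\<^esub>"
  unfolding quot_mod_def by simp_all

lemma quot_mod_smult:
  assumes r: "r \<in> carrier R" and m: "m \<in> carrier M"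
  shows "(J +> r) \<odot>\<^bsub>quot_mod R J M\<^esub> m = r \<odot>\<^bsub>M\<^esub> m"
proof -
  have "(SOME x. x \<in> J +> r) \<in> J +> r"
    using J.a_rcos_self[OF r] by (rule someI[where P="\<lambda>x. x \<in> J +> r"])
  then obtain j where "j \<in> J" "(SOME x. x \<in> J +> r) = j \<oplus> r"
    using rcoset_mem_iff r by auto
  then show ?thesis
    unfolding quot_mod_def using r m J_annihilates by (simp add: smult_l_distr)
qed

lemma quot_mod_module: "module (R Quot J) (quot_mod R J M)"
proof (rule moduleI)
  show "cring (R Quot J)"
    using J.quotient_is_cring is_cring by blast
  show "abelian_group (quot_mod R J M)"
  proof (rule abelian_groupI, simp_all only: quot_mod_simps)
    fix x assume "x \<in> carrier M"
    then show "\<exists>y\<in>carrier M. y \<oplus>\<^bsub>M\<^esub> x = \<zero>\<^bsub>M\<^esub>"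
      using M.l_neg M.a_inv_closed by blast
  qed (simp_all add: M.a_ac)
next
  fix a x assume "a \<in> carrier (R Quot J)" "x \<in> carrier (quot_mod R J M)"
  then show "a \<odot>\<^bsub>quot_mod R J M\<^esub> x \<in> carrier (quot_mod R J M)"
    using quot_mod_smult Quot_carrier_iff quot_mod_simps by auto
next
  fix a b x assume "a \<in> carrier (R Quot J)" "b \<in> carrier (R Quot J)" "x \<in> carrier (quot_mod R J M)"
  then obtain a' b' where "a' \<in> carrier R" "b' \<in> carrier R" "a = J +> a'" "b = J +> b'" "x \<in> carrier M"
    using Quot_carrier_iff quot_mod_simps by auto
  then show "(a \<oplus>\<^bsub>R Quot J\<^esub> b) \<odot>\<^bsub>quot_mod R J M\<^esub> x
      = a \<odot>\<^bsub>quot_mod R J M\<^esub> x \<oplus>\<^bsub>quot_mod R J M\<^esub> b \<odot>\<^bsub>quot_mod R J M\<^esub> x"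
    and "(a \<otimes>\<^bsub>R Quot J\<^esub> b) \<odot>\<^bsub>quot_mod R J M\<^esub> x = a \<odot>\<^bsub>quot_mod R J M\<^esub> (b \<odot>\<^bsub>quot_mod R J M\<^esub> x)"
    using Quot_add Quot_mult quot_mod_smult quot_mod_simps by (simp_all add: smult_l_distr smult_assoc1)
next
  fix a x y assume "a \<in> carrier (R Quot J)" "x \<in> carrier (quot_mod R J M)" "y \<in> carrier (quot_mod R J M)"
  then show "a \<odot>\<^bsub>quot_mod R J M\<^esub> (x \<oplus>\<^bsub>quot_mod R J M\<^esub> y)
      = a \<odot>\<^bsub>quot_mod R J M\<^esub> x \<oplus>\<^bsub>quot_mod R J M\<^esub> a \<odot>\<^bsub>quot_mod R J M\<^esub> y"
    using quot_mod_smult Quot_carrier_iff quot_mod_simps by (auto simp: smult_r_distr)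
next
  fix x assume "x \<in> carrier (quot_mod R J M)"
  then show "\<one>\<^bsub>R Quot J\<^esub> \<odot>\<^bsub>quot_mod R J M\<^esub> x = x"
    using quot_mod_smult Quot_one quot_mod_simps by simp
qed

lemma quot_ideal_mem_iff: "c \<in> quot_ideal R I J \<longleftrightarrow> (\<exists>t\<in>I. c = J +> t)"
proof
  assume "c \<in> quot_ideal R I J"
  then obtain i j where ij: "i \<in> I" "j \<in> J" "c = J +> (i \<oplus> j)"
    unfolding quot_ideal_def set_add_def' by auto
  have "i \<oplus> j = j \<oplus> i"
    using I.Icarr[OF ij(1)] J.Icarr[OF ij(2)] by (rule R.a_comm)
  then have "i \<oplus> j \<in> J +> i"
    using ij(2) rcoset_mem_iff[OF I.Icarr[OF ij(1)]] by blast
  then have "J +> i = J +> (i \<oplus> j)"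
    using J.a_repr_independence' I.Icarr[OF ij(1)] by blast
  then show "\<exists>t\<in>I. c = J +> t"
    using ij by auto
next
  assume "\<exists>t\<in>I. c = J +> t"
  then obtain t where t: "t \<in> I" "c = J +> t"
    by auto
  have "\<zero> \<in> J"
    by (rule additive_subgroup.zero_closed[OF J.additive_subgroup_axioms])
  then have "t \<oplus> \<zero> \<in> I <+> J"
    unfolding set_add_def' using t(1) by blast
  moreover have "c = J +> (t \<oplus> \<zero>)"
    using t I.Icarr by simp
  ultimately show "c \<in> quot_ideal R I J"
    unfolding quot_ideal_def by blast
qed

lemma quot_idealE:
  assumes "c \<in> quot_ideal R I J"
  obtains t where "t \<in> I" "c = J +> t"
  using assms quot_ideal_mem_iff by auto

sublocale HQ: module_ideal "R Quot J" "quot_mod R J M" "quot_ideal R I J"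
proof -
  interpret Q: module "R Quot J" "quot_mod R J M"
    by (rule quot_mod_module)
  show "module_ideal (R Quot J) (quot_mod R J M) (quot_ideal R I J)"
  proof
    show "quot_ideal R I J \<subseteq> carrier (R Quot J)"
    proof
      fix c assume "c \<in> quot_ideal R I J"
      then obtain t where "t \<in> I" "c = J +> t"
        by (rule quot_idealE)
      then show "c \<in> carrier (R Quot J)"
        unfolding Quot_carrier_iff using I.Icarr by blast
    qed
  next
    fix c d assume c: "c \<in> quot_ideal R I J" and d: "d \<in> quot_ideal R I J"
    obtain s where "s \<in> I" "c = J +> s"
      using c by (rule quot_idealE)
    moreover obtain t where "t \<in> I" "d = J +> t"
      using d by (rule quot_idealE)
    ultimately show "c \<oplus>\<^bsub>R Quot J\<^esub> d \<in> quot_ideal R I J"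
      unfolding quot_ideal_mem_iff using Quot_add I.Icarr I.a_closed by auto
  next
    fix r c assume r: "r \<in> carrier (R Quot J)" and c: "c \<in> quot_ideal R I J"
    obtain a where "a \<in> carrier R" "r = J +> a"
      using r Quot_carrier_iff by blast
    moreover obtain t where "t \<in> I" "c = J +> t"
      using c by (rule quot_idealE)
    ultimately show "r \<otimes>\<^bsub>R Quot J\<^esub> c \<in> quot_ideal R I J"
      unfolding quot_ideal_mem_iff using Quot_mult I.Icarr I.I_l_closed by auto
  qed
qed

lemma Zset_rcoset_cong:
  assumes \<phi>: "\<phi> \<in> Zset R I M" and t: "t \<in> I" "t' \<in> I" and eq: "J +> t = J +> t'"
  shows "\<phi> t = \<phi> t'"
proof -
  have "t' \<in> J +> t"
    using eq J.a_rcos_self I.Icarr[OF t(2)] by simp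
  then obtain j where j: "j \<in> J" "t' = j \<oplus> t"
    using rcoset_mem_iff I.Icarr[OF t(1)] by auto
  have "j = t' \<oplus> \<ominus> t"
    using j J.Icarr I.Icarr[OF t(1)] by (simp add: R.a_assoc R.r_neg)
  then have jI: "j \<in> I"
    using t I.a_closed I.a_inv_closed by simp
  obtain m where "m \<in> carrier M" "\<phi> j = j \<odot>\<^bsub>M\<^esub> m"
    using HM.ZsetD(4)[OF \<phi> jI] by blast
  then have "\<phi> j = \<zero>\<^bsub>M\<^esub>"
    using J_annihilates[OF j(1)] by simp
  then show ?thesis
    using j(2) HM.ZsetD(2)[OF \<phi> jI t(1)] HM.Zset_closed[OF \<phi> t(1)] by simp
qed

definition quot_lift where
  "quot_lift \<phi> = (\<lambda>c\<in>quot_ideal R I J. \<phi> (SOME t. t \<in> I \<and> c = J +> t))"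

lemma quot_lift_rcoset:
  assumes \<phi>: "\<phi> \<in> Zset R I M" and t: "t \<in> I"
  shows "quot_lift \<phi> (J +> t) = \<phi> t"
proof -
  define t' where "t' = (SOME t'. t' \<in> I \<and> J +> t = J +> t')"
  have t': "t' \<in> I \<and> J +> t = J +> t'"
    unfolding t'_def using t by (intro someI[where P="\<lambda>t'. t' \<in> I \<and> J +> t = J +> t'"]) simp
  have "J +> t \<in> quot_ideal R I J"
    using quot_ideal_mem_iff t by auto
  then have "quot_lift \<phi> (J +> t) = \<phi> t'"
    unfolding quot_lift_def t'_def by simp
  also have "\<dots> = \<phi> t"
    using Zset_rcoset_cong[OF \<phi> t _ ] t' by metis
  finally show ?thesis .
qed

lemma quot_lift_Zset:
  assumes \<phi>: "\<phi> \<in> Zset R I M"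
  shows "quot_lift \<phi> \<in> Zset (R Quot J) (quot_ideal R I J) (quot_mod R J M)"
proof (rule HQ.ZsetI)
  show "quot_lift \<phi> \<in> quot_ideal R I J \<rightarrow>\<^sub>E carrier (quot_mod R J M)"
  proof
    fix c assume "c \<in> quot_ideal R I J"
    then obtain t where "t \<in> I" "c = J +> t"
      by (rule quot_idealE)
    then show "quot_lift \<phi> c \<in> carrier (quot_mod R J M)"
      using quot_lift_rcoset[OF \<phi>] HM.Zset_closed[OF \<phi>] quot_mod_simps by simp
  qed (simp add: quot_lift_def)
next
  fix c d assume c: "c \<in> quot_ideal R I J" and d: "d \<in> quot_ideal R I J"
  obtain s where "s \<in> I" "c = J +> s"
    using c by (rule quot_idealE)
  moreover obtain t where "t \<in> I" "d = J +> t"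
    using d by (rule quot_idealE)
  ultimately show "quot_lift \<phi> (c \<oplus>\<^bsub>R Quot J\<^esub> d) = quot_lift \<phi> c \<oplus>\<^bsub>quot_mod R J M\<^esub> quot_lift \<phi> d"
    using Quot_add I.Icarr quot_lift_rcoset[OF \<phi>] I.a_closed HM.ZsetD(2)[OF \<phi>] quot_mod_simps by simp
next
  fix r c assume r: "r \<in> carrier (R Quot J)" and c: "c \<in> quot_ideal R I J"
  obtain a where "a \<in> carrier R" "r = J +> a"
    using r Quot_carrier_iff by blast
  moreover obtain t where "t \<in> I" "c = J +> t"
    using c by (rule quot_idealE)
  ultimately show "quot_lift \<phi> (r \<otimes>\<^bsub>R Quot J\<^esub> c) = r \<odot>\<^bsub>quot_mod R J M\<^esub> quot_lift \<phi> c"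
    using Quot_mult I.Icarr quot_lift_rcoset[OF \<phi>] I.I_l_closed HM.ZsetD(3)[OF \<phi>] quot_mod_smult
      HM.Zset_closed[OF \<phi>]
    by simp
next
  fix c assume "c \<in> quot_ideal R I J"
  then obtain t where t: "t \<in> I" "c = J +> t"
    by (rule quot_idealE)
  obtain m where "m \<in> carrier M" "\<phi> t = t \<odot>\<^bsub>M\<^esub> m"
    using HM.ZsetD(4)[OF \<phi> t(1)] by blast
  then show "\<exists>m\<in>carrier (quot_mod R J M). quot_lift \<phi> c = c \<odot>\<^bsub>quot_mod R J M\<^esub> m"
    using t quot_lift_rcoset[OF \<phi>] quot_mod_smult I.Icarr quot_mod_simps by auto
qed

lemma can_quot_Hclass:
  assumes \<phi>: "\<phi> \<in> Zset R I M"
  shows "can_quot R I J M (Hclass R I M \<phi>) = Hclass (R Quot J) (quot_ideal R I J) (quot_mod R J M) (quot_lift \<phi>)"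
proof -
  define \<psi> where "\<psi> = (SOME \<psi>. \<psi> \<in> Hclass R I M \<phi>)"
  have \<psi>: "\<psi> \<in> Zset R I M" "cohomologous I M \<phi> \<psi>"
    using HM.some_Hclass[OF \<phi>] unfolding \<psi>_def by auto
  then obtain m where m: "m \<in> carrier M" "\<forall>t\<in>I. \<psi> t = \<phi> t \<oplus>\<^bsub>M\<^esub> t \<odot>\<^bsub>M\<^esub> m"
    unfolding cohomologous_def by auto
  have "cohomologous (quot_ideal R I J) (quot_mod R J M) (quot_lift \<phi>) (quot_lift \<psi>)"
    unfolding cohomologous_def
  proof (intro bexI ballI)
    show "m \<in> carrier (quot_mod R J M)"
      using m quot_mod_simps by simp
    fix c assume "c \<in> quot_ideal R I J"
    then obtain t where t: "t \<in> I" "c = J +> t"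
      by (rule quot_idealE)
    then show "quot_lift \<psi> c = quot_lift \<phi> c \<oplus>\<^bsub>quot_mod R J M\<^esub> c \<odot>\<^bsub>quot_mod R J M\<^esub> m"
      using quot_lift_rcoset[OF \<phi>] quot_lift_rcoset[OF \<psi>(1)] m quot_mod_smult I.Icarr quot_mod_simps by simp
  qed
  then show ?thesis
    using HQ.Hclass_eq_iff[OF quot_lift_Zset[OF \<phi>] quot_lift_Zset[OF \<psi>(1)]]
    unfolding can_quot_def Let_def \<psi>_def[symmetric] quot_lift_def[symmetric] by simp
qed

lemma quot_lift_hadd:
  assumes "\<phi> \<in> Zset R I M" "\<psi> \<in> Zset R I M"
  shows "quot_lift (hadd I M \<phi> \<psi>) = hadd (quot_ideal R I J) (quot_mod R J M) (quot_lift \<phi>) (quot_lift \<psi>)"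
proof
  fix c
  show "quot_lift (hadd I M \<phi> \<psi>) c = hadd (quot_ideal R I J) (quot_mod R J M) (quot_lift \<phi>) (quot_lift \<psi>) c"
  proof (cases "c \<in> quot_ideal R I J")
    case True
    then obtain t where "t \<in> I" "c = J +> t"
      by (rule quot_idealE)
    then show ?thesis
      using quot_lift_rcoset assms HM.hadd_Zset[OF assms] True quot_mod_simps by (simp add: hadd_def)
  qed (simp add: quot_lift_def hadd_def)
qed

lemma quot_lift_hsmult:
  assumes r: "r \<in> carrier R" and \<phi>: "\<phi> \<in> Zset R I M"
  shows "quot_lift (hsmult I M r \<phi>) = hsmult (quot_ideal R I J) (quot_mod R J M) (J +> r) (quot_lift \<phi>)"
proof
  fix c
  show "quot_lift (hsmult I M r \<phi>) c = hsmult (quot_ideal R I J) (quot_mod R J M) (J +> r) (quot_lift \<phi>) c"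
  proof (cases "c \<in> quot_ideal R I J")
    case True
    then obtain t where "t \<in> I" "c = J +> t"
      by (rule quot_idealE)
    then show ?thesis
      using quot_lift_rcoset \<phi> HM.hsmult_Zset[OF r \<phi>] True quot_mod_smult[OF r] HM.Zset_closed[OF \<phi>]
      by (simp add: hsmult_def)
  qed (simp add: quot_lift_def hsmult_def)
qed

lemma can_quot_add:
  assumes x: "x \<in> carrier (Hmod R I M)" and y: "y \<in> carrier (Hmod R I M)"
  shows "can_quot R I J M (x \<oplus>\<^bsub>Hmod R I M\<^esub> y)
    = can_quot R I J M x \<oplus>\<^bsub>Hmod (R Quot J) (quot_ideal R I J) (quot_mod R J M)\<^esub> can_quot R I J M y"
proof -
  obtain \<phi> where \<phi>: "\<phi> \<in> Zset R I M" "x = Hclass R I M \<phi>"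
    using x by (rule HmodE)
  obtain \<psi> where \<psi>: "\<psi> \<in> Zset R I M" "y = Hclass R I M \<psi>"
    using y by (rule HmodE)
  show ?thesis
    unfolding \<phi>(2) \<psi>(2) HM.Hmod_add[OF \<phi>(1) \<psi>(1)] can_quot_Hclass[OF HM.hadd_Zset[OF \<phi>(1) \<psi>(1)]]
      can_quot_Hclass[OF \<phi>(1)] can_quot_Hclass[OF \<psi>(1)] quot_lift_hadd[OF \<phi>(1) \<psi>(1)]
      HQ.Hmod_add[OF quot_lift_Zset[OF \<phi>(1)] quot_lift_Zset[OF \<psi>(1)]] ..
qed

lemma can_quot_smult:
  assumes r: "r \<in> carrier R" and x: "x \<in> carrier (Hmod R I M)"
  shows "can_quot R I J M (r \<odot>\<^bsub>Hmod R I M\<^esub> x)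
    = (J +> r) \<odot>\<^bsub>Hmod (R Quot J) (quot_ideal R I J) (quot_mod R J M)\<^esub> can_quot R I J M x"
proof -
  obtain \<phi> where \<phi>: "\<phi> \<in> Zset R I M" "x = Hclass R I M \<phi>"
    using x by (rule HmodE)
  have "J +> r \<in> carrier (R Quot J)"
    using Quot_carrier_iff r by auto
  then show ?thesis
    unfolding \<phi>(2) HM.Hmod_smult[OF r \<phi>(1)] can_quot_Hclass[OF HM.hsmult_Zset[OF r \<phi>(1)]]
      can_quot_Hclass[OF \<phi>(1)] quot_lift_hsmult[OF r \<phi>(1)]
    by (simp add: HQ.Hmod_smult quot_lift_Zset[OF \<phi>(1)])
qed

lemma can_quot_inj: "inj_on (can_quot R I J M) (carrier (Hmod R I M))"
proof (rule inj_onI)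
  fix x y assume x: "x \<in> carrier (Hmod R I M)" and y: "y \<in> carrier (Hmod R I M)"
    and eq: "can_quot R I J M x = can_quot R I J M y"
  obtain \<phi> where \<phi>: "\<phi> \<in> Zset R I M" "x = Hclass R I M \<phi>"
    using x by (rule HmodE)
  obtain \<psi> where \<psi>: "\<psi> \<in> Zset R I M" "y = Hclass R I M \<psi>"
    using y by (rule HmodE)
  have "cohomologous (quot_ideal R I J) (quot_mod R J M) (quot_lift \<phi>) (quot_lift \<psi>)"
    using eq HQ.Hclass_eq_iff[OF quot_lift_Zset[OF \<phi>(1)] quot_lift_Zset[OF \<psi>(1)]]
    unfolding \<phi>(2) \<psi>(2) can_quot_Hclass[OF \<phi>(1)] can_quot_Hclass[OF \<psi>(1)] by simp
  then obtain m where m: "m \<in> carrier M"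
    "\<forall>c\<in>quot_ideal R I J. quot_lift \<psi> c = quot_lift \<phi> c \<oplus>\<^bsub>M\<^esub> c \<odot>\<^bsub>quot_mod R J M\<^esub> m"
    unfolding cohomologous_def quot_mod_simps by auto
  have "\<psi> t = \<phi> t \<oplus>\<^bsub>M\<^esub> t \<odot>\<^bsub>M\<^esub> m" if t: "t \<in> I" for t
  proof -
    have "J +> t \<in> quot_ideal R I J"
      using quot_ideal_mem_iff t by auto
    then show ?thesis
      using m quot_lift_rcoset[OF \<phi>(1) t] quot_lift_rcoset[OF \<psi>(1) t] quot_mod_smult I.Icarr[OF t] by simp
  qed
  then have "cohomologous I M \<phi> \<psi>"
    unfolding cohomologous_def using m(1) by blast
  then show "x = y"
    unfolding \<phi>(2) \<psi>(2) using HM.Hclass_eq_iff[OF \<phi>(1) \<psi>(1)] by simp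
qed

lemma quot_lift_preimage:
  assumes \<psi>: "\<psi> \<in> Zset (R Quot J) (quot_ideal R I J) (quot_mod R J M)"
  shows "(\<lambda>t\<in>I. \<psi> (J +> t)) \<in> Zset R I M"
    and "quot_lift (\<lambda>t\<in>I. \<psi> (J +> t)) = \<psi>"
proof -
  have QI: "J +> t \<in> quot_ideal R I J" if "t \<in> I" for t
    using quot_ideal_mem_iff that by auto
  have Q: "J +> r \<in> carrier (R Quot J)" if "r \<in> carrier R" for r
    using Quot_carrier_iff that by auto
  show \<phi>: "(\<lambda>t\<in>I. \<psi> (J +> t)) \<in> Zset R I M"
  proof (rule HM.ZsetI)
    show "(\<lambda>t\<in>I. \<psi> (J +> t)) \<in> I \<rightarrow>\<^sub>E carrier M"
      using HQ.Zset_closed[OF \<psi> QI] quot_mod_simps by auto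
  next
    fix s t assume st: "s \<in> I" "t \<in> I"
    then show "(\<lambda>t\<in>I. \<psi> (J +> t)) (s \<oplus> t) = (\<lambda>t\<in>I. \<psi> (J +> t)) s \<oplus>\<^bsub>M\<^esub> (\<lambda>t\<in>I. \<psi> (J +> t)) t"
      using HQ.ZsetD(2)[OF \<psi> QI QI] Quot_add[OF I.Icarr I.Icarr] I.a_closed quot_mod_simps by simp
  next
    fix r t assume rt: "r \<in> carrier R" "t \<in> I"
    then show "(\<lambda>t\<in>I. \<psi> (J +> t)) (r \<otimes> t) = r \<odot>\<^bsub>M\<^esub> (\<lambda>t\<in>I. \<psi> (J +> t)) t"
      using HQ.ZsetD(3)[OF \<psi> Q QI] Quot_mult[OF _ I.Icarr] I.I_l_closed quot_mod_smult
        HQ.Zset_closed[OF \<psi> QI] quot_mod_simps by simp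
  next
    fix t assume t: "t \<in> I"
    obtain m where "m \<in> carrier (quot_mod R J M)" "\<psi> (J +> t) = (J +> t) \<odot>\<^bsub>quot_mod R J M\<^esub> m"
      using HQ.ZsetD(4)[OF \<psi> QI[OF t]] by blast
    then show "\<exists>m\<in>carrier M. (\<lambda>t\<in>I. \<psi> (J +> t)) t = t \<odot>\<^bsub>M\<^esub> m"
      using t quot_mod_smult I.Icarr quot_mod_simps by auto
  qed
  show "quot_lift (\<lambda>t\<in>I. \<psi> (J +> t)) = \<psi>"
  proof
    fix c
    show "quot_lift (\<lambda>t\<in>I. \<psi> (J +> t)) c = \<psi> c"
    proof (cases "c \<in> quot_ideal R I J")
      case True
      then obtain t where "t \<in> I" "c = J +> t"
        by (rule quot_idealE)
      then show ?thesis
        using quot_lift_rcoset[OF \<phi>] by simp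
    qed (use HQ.Zset_undefined[OF \<psi>] in \<open>simp add: quot_lift_def\<close>)
  qed
qed

lemma can_quot_bij:
  "bij_betw (can_quot R I J M) (carrier (Hmod R I M)) (carrier (Hmod (R Quot J) (quot_ideal R I J) (quot_mod R J M)))"
  unfolding bij_betw_def
proof (intro conjI can_quot_inj equalityI subsetI)
  fix y assume "y \<in> can_quot R I J M ` carrier (Hmod R I M)"
  then obtain \<phi> where "\<phi> \<in> Zset R I M" "y = can_quot R I J M (Hclass R I M \<phi>)"
    by (auto elim: HmodE)
  then show "y \<in> carrier (Hmod (R Quot J) (quot_ideal R I J) (quot_mod R J M))"
    using can_quot_Hclass Hclass_in_Hmod quot_lift_Zset by metis
next
  fix y assume "y \<in> carrier (Hmod (R Quot J) (quot_ideal R I J) (quot_mod R J M))"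
  then obtain \<psi> where \<psi>: "\<psi> \<in> Zset (R Quot J) (quot_ideal R I J) (quot_mod R J M)"
    "y = Hclass (R Quot J) (quot_ideal R I J) (quot_mod R J M) \<psi>"
    by (rule HmodE)
  then have "y = can_quot R I J M (Hclass R I M (\<lambda>t\<in>I. \<psi> (J +> t)))"
    using can_quot_Hclass quot_lift_preimage by metis
  then show "y \<in> can_quot R I J M ` carrier (Hmod R I M)"
    using Hclass_in_Hmod[OF quot_lift_preimage(1)[OF \<psi>(1)]] by blast
qed

end

section \<open>Localisation\<close>

text \<open>The relation defining \<open>loc_cls\<close>, with \<open>u (s' m - s m') = 0\<close> rewritten as an equation.\<close>

definition frac_rel where
  "frac_rel R S M m s m' s' \<longleftrightarrow> (\<exists>u\<in>S. (u \<otimes>\<^bsub>R\<^esub> s') \<odot>\<^bsub>M\<^esub> m = (u \<otimes>\<^bsub>R\<^esub> s) \<odot>\<^bsub>M\<^esub> m')"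

lemma ring_mod_simps:
  "carrier (ring_mod R) = carrier R" "x \<oplus>\<^bsub>ring_mod R\<^esub> y = x \<oplus>\<^bsub>R\<^esub> y" "\<zero>\<^bsub>ring_mod R\<^esub> = \<zero>\<^bsub>R\<^esub>"
  "a \<odot>\<^bsub>ring_mod R\<^esub> x = a \<otimes>\<^bsub>R\<^esub> x"
  unfolding ring_mod_def by simp_all

lemma ring_mod_module:
  assumes "cring R"
  shows "module R (ring_mod R)"
proof -
  interpret cring R by fact
  show ?thesis
  proof (rule moduleI[OF assms])
    show "abelian_group (ring_mod R)"
    proof (rule abelian_groupI, simp_all only: ring_mod_simps)
      fix x assume "x \<in> carrier R"
      then show "\<exists>y\<in>carrier R. y \<oplus>\<^bsub>R\<^esub> x = \<zero>\<^bsub>R\<^esub>"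
        using l_neg a_inv_closed by blast
    qed (simp_all add: a_ac)
  qed (simp_all add: ring_mod_simps l_distr r_distr m_assoc)
qed

lemma loc_ring_eqs:
  "carrier (loc_ring R S) = carrier (loc_mod R S (ring_mod R))"
  "x \<oplus>\<^bsub>loc_ring R S\<^esub> y = x \<oplus>\<^bsub>loc_mod R S (ring_mod R)\<^esub> y"
  "x \<otimes>\<^bsub>loc_ring R S\<^esub> y = x \<odot>\<^bsub>loc_mod R S (ring_mod R)\<^esub> y"
  unfolding loc_ring_def loc_mod_def ring_mod_def by simp_all

lemma mult_set_common_multiple:
  assumes S: "mult_set R S" and R: "cring R" and G: "finite G"
    and closed: "\<And>v g a. P v g \<Longrightarrow> v \<in> S \<Longrightarrow> a \<in> S \<Longrightarrow> P (a \<otimes>\<^bsub>R\<^esub> v) g"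
    and ex: "\<And>g. g \<in> G \<Longrightarrow> \<exists>v\<in>S. P v g"
  shows "\<exists>v\<in>S. \<forall>g\<in>G. P v g"
  using G ex
proof (induction G rule: finite_induct)
  case empty
  then show ?case
    using S unfolding mult_set_def by auto
next
  case (insert g G)
  then obtain v where v: "v \<in> S" "\<forall>g\<in>G. P v g"
    by auto
  obtain w where w: "w \<in> S" "P w g"
    using insert by auto
  have S_carrier: "S \<subseteq> carrier R" and S_mult: "\<forall>s\<in>S. \<forall>u\<in>S. s \<otimes>\<^bsub>R\<^esub> u \<in> S"
    using S unfolding mult_set_def by auto
  have "w \<otimes>\<^bsub>R\<^esub> v = v \<otimes>\<^bsub>R\<^esub> w"
    using S_carrier v(1) w(1) cring.cring_simprules(14)[OF R] by blast
  then have "P (w \<otimes>\<^bsub>R\<^esub> v) g"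
    using closed[OF w(2) w(1) v(1)] by simp
  moreover have "\<forall>g\<in>G. P (w \<otimes>\<^bsub>R\<^esub> v) g"
    using closed v w by blast
  ultimately show ?case
    using S_mult v w by blast
qed

locale mult_set_module = module +
  fixes S :: "'a set"
  assumes mult_set: "mult_set R S"
begin

lemma S_carrier: "s \<in> S \<Longrightarrow> s \<in> carrier R"
  using mult_set unfolding mult_set_def by auto

lemma one_in_S: "\<one> \<in> S"
  using mult_set unfolding mult_set_def by auto

lemma S_mult_closed: "s \<in> S \<Longrightarrow> u \<in> S \<Longrightarrow> s \<otimes> u \<in> S"
  using mult_set unfolding mult_set_def by auto

lemma loc_cls_mem_iff:
  assumes m: "m \<in> carrier M" and s: "s \<in> S"
  shows "p \<in> loc_cls R S M m s \<longleftrightarrow> fst p \<in> carrier M \<and> snd p \<in> S \<and> frac_rel R S M m s (fst p) (snd p)"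
proof -
  have diff_eq_zero: "x \<ominus>\<^bsub>M\<^esub> y = \<zero>\<^bsub>M\<^esub> \<longleftrightarrow> x = y" if "x \<in> carrier M" "y \<in> carrier M" for x y
    using that by (metis M.minus_equality M.minus_minus M.r_neg a_minus_def M.a_inv_closed)
  have "u \<odot>\<^bsub>M\<^esub> (s' \<odot>\<^bsub>M\<^esub> m \<ominus>\<^bsub>M\<^esub> s \<odot>\<^bsub>M\<^esub> m') = \<zero>\<^bsub>M\<^esub> \<longleftrightarrow> (u \<otimes> s') \<odot>\<^bsub>M\<^esub> m = (u \<otimes> s) \<odot>\<^bsub>M\<^esub> m'"
    if "u \<in> S" "s' \<in> S" "m' \<in> carrier M" for u s' m'
    using that m s S_carrier
    by (simp add: a_minus_def smult_r_distr smult_r_minus diff_eq_zero[symmetric] smult_assoc1)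
  then show ?thesis
    unfolding loc_cls_def frac_rel_def by (cases p) auto
qed

lemma frac_rel_refl: "frac_rel R S M m s m s"
  unfolding frac_rel_def using one_in_S by blast

lemma frac_rel_sym: "frac_rel R S M m s m' s' \<Longrightarrow> frac_rel R S M m' s' m s"
  unfolding frac_rel_def by metis

lemma frac_rel_trans:
  assumes c: "m \<in> carrier M" "m' \<in> carrier M" "m'' \<in> carrier M" "s \<in> S" "s' \<in> S" "s'' \<in> S"
    and r1: "frac_rel R S M m s m' s'" and r2: "frac_rel R S M m' s' m'' s''"
  shows "frac_rel R S M m s m'' s''"
proof -
  obtain u where u: "u \<in> S" "(u \<otimes> s') \<odot>\<^bsub>M\<^esub> m = (u \<otimes> s) \<odot>\<^bsub>M\<^esub> m'"
    using r1 unfolding frac_rel_def by auto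
  obtain v where v: "v \<in> S" "(v \<otimes> s'') \<odot>\<^bsub>M\<^esub> m' = (v \<otimes> s') \<odot>\<^bsub>M\<^esub> m''"
    using r2 unfolding frac_rel_def by auto
  note C = c(4,5,6)[THEN S_carrier] u(1)[THEN S_carrier] v(1)[THEN S_carrier]
  have "((u \<otimes> v \<otimes> s') \<otimes> s'') \<odot>\<^bsub>M\<^esub> m = (v \<otimes> s'') \<odot>\<^bsub>M\<^esub> ((u \<otimes> s') \<odot>\<^bsub>M\<^esub> m)"
  proof -
    have "(u \<otimes> v \<otimes> s') \<otimes> s'' = (v \<otimes> s'') \<otimes> (u \<otimes> s')"
      using C by algebra
    then show ?thesis
      using C c by (simp add: smult_assoc1)
  qed
  also have "\<dots> = (v \<otimes> s'') \<odot>\<^bsub>M\<^esub> ((u \<otimes> s) \<odot>\<^bsub>M\<^esub> m')"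
    using u by simp
  also have "\<dots> = (u \<otimes> s) \<odot>\<^bsub>M\<^esub> ((v \<otimes> s'') \<odot>\<^bsub>M\<^esub> m')"
    using C c by (simp add: smult_assoc1[symmetric] m_comm)
  also have "\<dots> = (u \<otimes> s) \<odot>\<^bsub>M\<^esub> ((v \<otimes> s') \<odot>\<^bsub>M\<^esub> m'')"
    using v by simp
  also have "\<dots> = ((u \<otimes> v \<otimes> s') \<otimes> s) \<odot>\<^bsub>M\<^esub> m''"
  proof -
    have "(u \<otimes> v \<otimes> s') \<otimes> s = (u \<otimes> s) \<otimes> (v \<otimes> s')"
      using C by algebra
    then show ?thesis
      using C c by (simp add: smult_assoc1)
  qed
  finally show ?thesis
    unfolding frac_rel_def using u(1) v(1) c S_mult_closed by blast
qed

lemma loc_cls_self: "m \<in> carrier M \<Longrightarrow> s \<in> S \<Longrightarrow> (m, s) \<in> loc_cls R S M m s"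
  using loc_cls_mem_iff frac_rel_refl by auto

lemma loc_cls_eq_iff:
  assumes "m \<in> carrier M" "s \<in> S" "m' \<in> carrier M" "s' \<in> S"
  shows "loc_cls R S M m s = loc_cls R S M m' s' \<longleftrightarrow> frac_rel R S M m s m' s'"
proof
  assume "loc_cls R S M m s = loc_cls R S M m' s'"
  then have "(m', s') \<in> loc_cls R S M m s"
    using loc_cls_self assms by auto
  then show "frac_rel R S M m s m' s'"
    using loc_cls_mem_iff assms by auto
next
  assume "frac_rel R S M m s m' s'"
  then show "loc_cls R S M m s = loc_cls R S M m' s'"
    unfolding set_eq_iff loc_cls_mem_iff[OF assms(1,2)] loc_cls_mem_iff[OF assms(3,4)]
    using frac_rel_sym frac_rel_trans assms by meson
qed

lemma loc_cls_eqI: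
  assumes "m \<in> carrier M" "s \<in> S" "m' \<in> carrier M" "s' \<in> S" and "s' \<odot>\<^bsub>M\<^esub> m = s \<odot>\<^bsub>M\<^esub> m'"
  shows "loc_cls R S M m s = loc_cls R S M m' s'"
  using assms one_in_S S_carrier unfolding loc_cls_eq_iff[OF assms(1-4)] frac_rel_def by (metis l_one)

lemma some_loc_cls:
  assumes "m \<in> carrier M" "s \<in> S"
  obtains m' s' where "(SOME p. p \<in> loc_cls R S M m s) = (m', s')"
    "m' \<in> carrier M" "s' \<in> S" "frac_rel R S M m s m' s'"
proof -
  have "(SOME p. p \<in> loc_cls R S M m s) \<in> loc_cls R S M m s"
    using loc_cls_self[OF assms] by (rule someI)
  then show ?thesis
    using that loc_cls_mem_iff[OF assms] by (metis prod.collapse)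
qed

lemma loc_mod_carrier_iff: "x \<in> carrier (loc_mod R S M) \<longleftrightarrow> (\<exists>m\<in>carrier M. \<exists>s\<in>S. x = loc_cls R S M m s)"
  unfolding loc_mod_def by auto

lemma loc_mod_zero: "\<zero>\<^bsub>loc_mod R S M\<^esub> = loc_cls R S M \<zero>\<^bsub>M\<^esub> \<one>"
  unfolding loc_mod_def by simp

lemma frac_rel_add:
  assumes c: "m \<in> carrier M" "n \<in> carrier M" "m' \<in> carrier M" "n' \<in> carrier M"
    "s \<in> S" "u \<in> S" "s' \<in> S" "u' \<in> S"
    and r1: "frac_rel R S M m s m' s'" and r2: "frac_rel R S M n u n' u'"
  shows "frac_rel R S M (u \<odot>\<^bsub>M\<^esub> m \<oplus>\<^bsub>M\<^esub> s \<odot>\<^bsub>M\<^esub> n) (s \<otimes> u) (u' \<odot>\<^bsub>M\<^esub> m' \<oplus>\<^bsub>M\<^esub> s' \<odot>\<^bsub>M\<^esub> n') (s' \<otimes> u')"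
proof -
  obtain v where v: "v \<in> S" "(v \<otimes> s') \<odot>\<^bsub>M\<^esub> m = (v \<otimes> s) \<odot>\<^bsub>M\<^esub> m'"
    using r1 unfolding frac_rel_def by auto
  obtain w where w: "w \<in> S" "(w \<otimes> u') \<odot>\<^bsub>M\<^esub> n = (w \<otimes> u) \<odot>\<^bsub>M\<^esub> n'"
    using r2 unfolding frac_rel_def by auto
  note C = c(5-8)[THEN S_carrier] v(1)[THEN S_carrier] w(1)[THEN S_carrier]
  have "((v \<otimes> w) \<otimes> (s' \<otimes> u')) \<odot>\<^bsub>M\<^esub> (u \<odot>\<^bsub>M\<^esub> m \<oplus>\<^bsub>M\<^esub> s \<odot>\<^bsub>M\<^esub> n)
      = (w \<otimes> u' \<otimes> u) \<odot>\<^bsub>M\<^esub> ((v \<otimes> s') \<odot>\<^bsub>M\<^esub> m) \<oplus>\<^bsub>M\<^esub> (v \<otimes> s' \<otimes> s) \<odot>\<^bsub>M\<^esub> ((w \<otimes> u') \<odot>\<^bsub>M\<^esub> n)"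
  proof -
    have "((v \<otimes> w) \<otimes> (s' \<otimes> u')) \<otimes> u = (w \<otimes> u' \<otimes> u) \<otimes> (v \<otimes> s')"
      "((v \<otimes> w) \<otimes> (s' \<otimes> u')) \<otimes> s = (v \<otimes> s' \<otimes> s) \<otimes> (w \<otimes> u')"
      using C by algebra+
    then show ?thesis
      using C c by (simp add: smult_r_distr smult_assoc1[symmetric])
  qed
  also have "\<dots> = (w \<otimes> u' \<otimes> u) \<odot>\<^bsub>M\<^esub> ((v \<otimes> s) \<odot>\<^bsub>M\<^esub> m') \<oplus>\<^bsub>M\<^esub> (v \<otimes> s' \<otimes> s) \<odot>\<^bsub>M\<^esub> ((w \<otimes> u) \<odot>\<^bsub>M\<^esub> n')"
    using v w by simp
  also have "\<dots> = ((v \<otimes> w) \<otimes> (s \<otimes> u)) \<odot>\<^bsub>M\<^esub> (u' \<odot>\<^bsub>M\<^esub> m' \<oplus>\<^bsub>M\<^esub> s' \<odot>\<^bsub>M\<^esub> n')"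
  proof -
    have "((v \<otimes> w) \<otimes> (s \<otimes> u)) \<otimes> u' = (w \<otimes> u' \<otimes> u) \<otimes> (v \<otimes> s)"
      "((v \<otimes> w) \<otimes> (s \<otimes> u)) \<otimes> s' = (v \<otimes> s' \<otimes> s) \<otimes> (w \<otimes> u)"
      using C by algebra+
    then show ?thesis
      using C c by (simp add: smult_r_distr smult_assoc1[symmetric])
  qed
  finally show ?thesis
    unfolding frac_rel_def using v(1) w(1) S_mult_closed by blast
qed

lemma loc_mod_add:
  assumes "m \<in> carrier M" "s \<in> S" "n \<in> carrier M" "u \<in> S"
  shows "loc_cls R S M m s \<oplus>\<^bsub>loc_mod R S M\<^esub> loc_cls R S M n u
       = loc_cls R S M (u \<odot>\<^bsub>M\<^esub> m \<oplus>\<^bsub>M\<^esub> s \<odot>\<^bsub>M\<^esub> n) (s \<otimes> u)"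
proof -
  obtain m' s' where p: "(SOME p. p \<in> loc_cls R S M m s) = (m', s')"
    "m' \<in> carrier M" "s' \<in> S" "frac_rel R S M m s m' s'"
    using some_loc_cls[OF assms(1,2)] .
  obtain n' u' where q: "(SOME p. p \<in> loc_cls R S M n u) = (n', u')"
    "n' \<in> carrier M" "u' \<in> S" "frac_rel R S M n u n' u'"
    using some_loc_cls[OF assms(3,4)] .
  have "loc_cls R S M (u' \<odot>\<^bsub>M\<^esub> m' \<oplus>\<^bsub>M\<^esub> s' \<odot>\<^bsub>M\<^esub> n') (s' \<otimes> u')
      = loc_cls R S M (u \<odot>\<^bsub>M\<^esub> m \<oplus>\<^bsub>M\<^esub> s \<odot>\<^bsub>M\<^esub> n) (s \<otimes> u)"
    using frac_rel_add[OF assms(1,3) p(2) q(2) assms(2,4) p(3) q(3) p(4) q(4)]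
      loc_cls_eq_iff frac_rel_sym assms p q S_carrier S_mult_closed
    by (metis M.a_closed smult_closed)
  then show ?thesis
    unfolding loc_mod_def using p(1) q(1) by simp
qed

lemma loc_mod_zero_closed: "\<zero>\<^bsub>loc_mod R S M\<^esub> \<in> carrier (loc_mod R S M)"
  unfolding loc_mod_zero loc_mod_carrier_iff using one_in_S by blast

lemma loc_mod_add_zero:
  assumes "x \<in> carrier (loc_mod R S M)"
  shows "x \<oplus>\<^bsub>loc_mod R S M\<^esub> \<zero>\<^bsub>loc_mod R S M\<^esub> = x"
proof -
  obtain m w where "m \<in> carrier M" "w \<in> S" "x = loc_cls R S M m w"
    using assms loc_mod_carrier_iff by auto
  then show ?thesis
    unfolding loc_mod_zero using loc_mod_add[of m w "\<zero>\<^bsub>M\<^esub>" \<one>] one_in_S S_carrier by simp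
qed

lemma hsmult_hom_lin:
  assumes J: "ideal J R" and r: "r \<in> carrier R" and \<chi>: "\<chi> \<in> hom_lin R J M"
  shows "hsmult J M r \<chi> \<in> hom_lin R J M"
proof -
  interpret J: ideal J R
    by (rule J)
  have c: "\<chi> t \<in> carrier M" if "t \<in> J" for t
    using \<chi> that unfolding hom_lin_def by auto
  have mult_closed: "a \<otimes> t \<in> J" if "a \<in> carrier R" "t \<in> J" for a t
    using J.I_l_closed that by blast
  show ?thesis
    using \<chi> r c J.a_closed mult_closed J.Icarr
    unfolding hom_lin_def hsmult_def by (auto simp: smult_r_distr smult_assoc1[symmetric] m_comm)
qed

lemma hom_lin_eq_after_scaling:
  assumes G: "finite G" "G \<subseteq> carrier R"
    and \<chi>1: "\<chi>1 \<in> hom_lin R (Idl G) M" and \<chi>2: "\<chi>2 \<in> hom_lin R (Idl G) M"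
    and pointwise: "\<And>t. t \<in> Idl G \<Longrightarrow> \<exists>v\<in>S. v \<odot>\<^bsub>M\<^esub> \<chi>1 t = v \<odot>\<^bsub>M\<^esub> \<chi>2 t"
  shows "\<exists>v\<in>S. \<forall>t\<in>Idl G. v \<odot>\<^bsub>M\<^esub> \<chi>1 t = v \<odot>\<^bsub>M\<^esub> \<chi>2 t"
proof -
  have closed: "\<chi>1 t \<in> carrier M" "\<chi>2 t \<in> carrier M" if "t \<in> Idl G" for t
    using \<chi>1 \<chi>2 that unfolding hom_lin_def by auto
  define P where "P v t \<longleftrightarrow> t \<in> Idl G \<and> v \<odot>\<^bsub>M\<^esub> \<chi>1 t = v \<odot>\<^bsub>M\<^esub> \<chi>2 t" for v t
  have "P (a \<otimes> v) t" if "P v t" "v \<in> S" "a \<in> S" for v t a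
    using that closed S_carrier unfolding P_def by (simp add: smult_assoc1)
  moreover have "\<exists>v\<in>S. P v g" if "g \<in> G" for g
    unfolding P_def using pointwise genideal_self[OF G(2)] that by blast
  ultimately obtain V where V: "V \<in> S" "\<And>g. g \<in> G \<Longrightarrow> P V g"
    using mult_set_common_multiple[OF mult_set is_cring G(1), of P] by blast
  have "hsmult (Idl G) M V \<chi>1 t = hsmult (Idl G) M V \<chi>2 t" if "t \<in> Idl G" for t
    using hom_lin_eq_on_generators[OF G(2) hsmult_hom_lin hsmult_hom_lin, OF _ _ \<chi>1 _ _ \<chi>2 _ that]
      genideal_ideal[OF G(2)] S_carrier[OF V(1)] V(2) genideal_self[OF G(2)]
    unfolding P_def hsmult_def by auto
  then show ?thesis
    using V(1) unfolding hsmult_def by auto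
qed

lemma frac_rel_smult:
  assumes c: "a \<in> carrier R" "a' \<in> carrier R" "m \<in> carrier M" "m' \<in> carrier M"
    "s \<in> S" "u \<in> S" "s' \<in> S" "u' \<in> S"
    and r1: "frac_rel R S (ring_mod R) a s a' s'" and r2: "frac_rel R S M m u m' u'"
  shows "frac_rel R S M (a \<odot>\<^bsub>M\<^esub> m) (s \<otimes> u) (a' \<odot>\<^bsub>M\<^esub> m') (s' \<otimes> u')"
proof -
  obtain v where v: "v \<in> S" "(v \<otimes> s') \<otimes> a = (v \<otimes> s) \<otimes> a'"
    using r1 unfolding frac_rel_def ring_mod_simps by auto
  obtain w where w: "w \<in> S" "(w \<otimes> u') \<odot>\<^bsub>M\<^esub> m = (w \<otimes> u) \<odot>\<^bsub>M\<^esub> m'"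
    using r2 unfolding frac_rel_def by auto
  note C = c(1,2,5-8) c(5-8)[THEN S_carrier] v(1)[THEN S_carrier] w(1)[THEN S_carrier]
  have "((v \<otimes> w) \<otimes> (s' \<otimes> u')) \<odot>\<^bsub>M\<^esub> (a \<odot>\<^bsub>M\<^esub> m) = (((v \<otimes> s') \<otimes> a) \<otimes> (w \<otimes> u')) \<odot>\<^bsub>M\<^esub> m"
  proof -
    have "((v \<otimes> w) \<otimes> (s' \<otimes> u')) \<otimes> a = ((v \<otimes> s') \<otimes> a) \<otimes> (w \<otimes> u')"
      using C by algebra
    then show ?thesis
      using C c by (simp add: smult_assoc1[symmetric])
  qed
  also have "\<dots> = (((v \<otimes> s) \<otimes> a') \<otimes> (w \<otimes> u')) \<odot>\<^bsub>M\<^esub> m"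
    using v by simp
  also have "\<dots> = ((v \<otimes> s) \<otimes> a') \<odot>\<^bsub>M\<^esub> ((w \<otimes> u) \<odot>\<^bsub>M\<^esub> m')"
    using C c w(2) by (simp add: smult_assoc1)
  also have "\<dots> = ((v \<otimes> w) \<otimes> (s \<otimes> u)) \<odot>\<^bsub>M\<^esub> (a' \<odot>\<^bsub>M\<^esub> m')"
  proof -
    have "((v \<otimes> s) \<otimes> a') \<otimes> (w \<otimes> u) = ((v \<otimes> w) \<otimes> (s \<otimes> u)) \<otimes> a'"
      using C by algebra
    then show ?thesis
      using C c by (simp add: smult_assoc1[symmetric])
  qed
  finally show ?thesis
    unfolding frac_rel_def using v(1) w(1) S_mult_closed by blast
qed

lemma loc_mod_smult:
  assumes "a \<in> carrier R" "s \<in> S" "m \<in> carrier M" "u \<in> S"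
  shows "loc_cls R S (ring_mod R) a s \<odot>\<^bsub>loc_mod R S M\<^esub> loc_cls R S M m u = loc_cls R S M (a \<odot>\<^bsub>M\<^esub> m) (s \<otimes> u)"
proof -
  interpret LR: mult_set_module R "ring_mod R" S
    unfolding mult_set_module_def mult_set_module_axioms_def
    using ring_mod_module[OF is_cring] mult_set by blast
  obtain a' s' where p: "(SOME p. p \<in> loc_cls R S (ring_mod R) a s) = (a', s')"
    "a' \<in> carrier R" "s' \<in> S" "frac_rel R S (ring_mod R) a s a' s'"
    using LR.some_loc_cls[of a s] assms(1,2) unfolding ring_mod_simps by metis
  obtain m' u' where q: "(SOME p. p \<in> loc_cls R S M m u) = (m', u')"
    "m' \<in> carrier M" "u' \<in> S" "frac_rel R S M m u m' u'"
    using some_loc_cls[OF assms(3,4)] .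
  have "loc_cls R S M (a' \<odot>\<^bsub>M\<^esub> m') (s' \<otimes> u') = loc_cls R S M (a \<odot>\<^bsub>M\<^esub> m) (s \<otimes> u)"
    using frac_rel_smult[OF assms(1) p(2) assms(3) q(2) assms(2,4) p(3) q(3) p(4) q(4)]
      loc_cls_eq_iff frac_rel_sym assms p q S_mult_closed
    by (metis smult_closed)
  then show ?thesis
    unfolding loc_mod_def using p(1) q(1) by simp
qed

end

locale H_localization = mult_set_module +
  fixes I :: "'a set"
  assumes I_ideal: "ideal I R"
begin

sublocale HM: module_ideal R M I
  using module_idealI[OF is_cring I_ideal module_axioms] .

sublocale LR: mult_set_module R "ring_mod R" S
  unfolding mult_set_module_def mult_set_module_axioms_def
  using ring_mod_module[OF is_cring] mult_set by blast

sublocale LH: mult_set_module R "Hmod R I M" S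
  unfolding mult_set_module_def mult_set_module_axioms_def
  using HM.Hmod_module mult_set by blast

abbreviation rfrac where "rfrac a s \<equiv> loc_cls R S (ring_mod R) a s"

abbreviation mfrac where "mfrac m s \<equiv> loc_cls R S M m s"

lemma loc_ideal_mem_iff: "c \<in> loc_ideal R S I \<longleftrightarrow> (\<exists>t\<in>I. \<exists>u\<in>S. c = rfrac t u)"
  unfolding loc_ideal_def by auto

lemma loc_idealE:
  assumes "c \<in> loc_ideal R S I"
  obtains t u where "t \<in> I" "u \<in> S" "c = rfrac t u"
  using assms loc_ideal_mem_iff by auto

lemma loc_ring_carrier_iff: "c \<in> carrier (loc_ring R S) \<longleftrightarrow> (\<exists>a\<in>carrier R. \<exists>v\<in>S. c = rfrac a v)"
  unfolding loc_ring_eqs LR.loc_mod_carrier_iff ring_mod_simps ..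

lemma loc_ring_add_frac:
  assumes "t \<in> carrier R" "u \<in> S" "t' \<in> carrier R" "u' \<in> S"
  shows "rfrac t u \<oplus>\<^bsub>loc_ring R S\<^esub> rfrac t' u' = rfrac (u' \<otimes> t \<oplus> u \<otimes> t') (u \<otimes> u')"
  using LR.loc_mod_add[of t u t' u'] assms unfolding loc_ring_eqs ring_mod_simps by simp

lemma loc_ring_mult_frac:
  assumes "a \<in> carrier R" "v \<in> S" "t \<in> carrier R" "u \<in> S"
  shows "rfrac a v \<otimes>\<^bsub>loc_ring R S\<^esub> rfrac t u = rfrac (a \<otimes> t) (v \<otimes> u)"
  using LR.loc_mod_smult[of a v t u] assms unfolding loc_ring_eqs ring_mod_simps by simp

lemma loc_ideal_subset: "loc_ideal R S I \<subseteq> carrier (loc_ring R S)"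
proof
  fix c assume "c \<in> loc_ideal R S I"
  then obtain t u where "t \<in> I" "u \<in> S" "c = rfrac t u"
    by (rule loc_idealE)
  then show "c \<in> carrier (loc_ring R S)"
    unfolding loc_ring_carrier_iff using HM.I_carrier by blast
qed

lemma loc_ideal_add_closed:
  assumes "c \<in> loc_ideal R S I" "d \<in> loc_ideal R S I"
  shows "c \<oplus>\<^bsub>loc_ring R S\<^esub> d \<in> loc_ideal R S I"
proof -
  obtain t u where c: "t \<in> I" "u \<in> S" "c = rfrac t u"
    using assms(1) by (rule loc_idealE)
  obtain t' u' where d: "t' \<in> I" "u' \<in> S" "d = rfrac t' u'"
    using assms(2) by (rule loc_idealE)
  have "u' \<otimes> t \<oplus> u \<otimes> t' \<in> I"
    using c d S_carrier HM.I_add_closed HM.I_mult_closed by blast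
  then show ?thesis
    unfolding c(3) d(3) loc_ring_add_frac[OF HM.I_carrier[OF c(1)] c(2) HM.I_carrier[OF d(1)] d(2)]
      loc_ideal_mem_iff using c(2) d(2) S_mult_closed by blast
qed

lemma loc_ideal_mult_closed:
  assumes "r \<in> carrier (loc_ring R S)" "c \<in> loc_ideal R S I"
  shows "r \<otimes>\<^bsub>loc_ring R S\<^esub> c \<in> loc_ideal R S I"
proof -
  obtain a v where r: "a \<in> carrier R" "v \<in> S" "r = rfrac a v"
    using assms(1) loc_ring_carrier_iff by blast
  obtain t u where c: "t \<in> I" "u \<in> S" "c = rfrac t u"
    using assms(2) by (rule loc_idealE)
  show ?thesis
    unfolding r(3) c(3) loc_ring_mult_frac[OF r(1,2) HM.I_carrier[OF c(1)] c(2)] loc_ideal_mem_iff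
    using HM.I_mult_closed[OF r(1) c(1)] S_mult_closed[OF r(2) c(2)] by blast
qed

lemma loc_hom_frac:
  assumes \<phi>: "\<phi> \<in> Zset R I M" and t: "t \<in> I" and u: "u \<in> S"
  shows "loc_hom R S I M \<phi> (rfrac t u) = mfrac (\<phi> t) u"
proof -
  have tc: "t \<in> carrier (ring_mod R)"
    using HM.I_carrier[OF t] unfolding ring_mod_simps .
  define q where "q = (SOME p. p \<in> rfrac t u \<and> fst p \<in> I)"
  have "q \<in> rfrac t u \<and> fst q \<in> I"
    unfolding q_def using LR.loc_cls_self[OF tc u] t
    by (intro someI[where P="\<lambda>p. p \<in> rfrac t u \<and> fst p \<in> I"]) auto
  then obtain t' u' where q: "q = (t', u')" "t' \<in> I" "u' \<in> S" "frac_rel R S (ring_mod R) t u t' u'"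
    using LR.loc_cls_mem_iff[OF tc u] by (cases q) auto
  then obtain w where w: "w \<in> S" "(w \<otimes> u') \<otimes> t = (w \<otimes> u) \<otimes> t'"
    unfolding frac_rel_def ring_mod_simps by auto
  have "(w \<otimes> u') \<odot>\<^bsub>M\<^esub> \<phi> t = (w \<otimes> u) \<odot>\<^bsub>M\<^esub> \<phi> t'"
    using HM.ZsetD(3)[OF \<phi>, of "w \<otimes> u'" t] HM.ZsetD(3)[OF \<phi>, of "w \<otimes> u" t'] w q t u S_carrier by simp
  then have "mfrac (\<phi> t') u' = mfrac (\<phi> t) u"
    using loc_cls_eq_iff[of "\<phi> t" u "\<phi> t'" u'] HM.Zset_closed[OF \<phi>] t u q w(1)
    unfolding frac_rel_def by auto
  moreover have "rfrac t u \<in> loc_ideal R S I"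
    using loc_ideal_mem_iff t u by auto
  ultimately show ?thesis
    unfolding loc_hom_def using q by (simp add: q_def[symmetric])
qed

definition loc_map where
  "loc_map \<phi> s = (\<lambda>c\<in>loc_ideal R S I. rfrac \<one> s \<odot>\<^bsub>loc_mod R S M\<^esub> loc_hom R S I M \<phi> c)"

lemma loc_map_frac:
  assumes \<phi>: "\<phi> \<in> Zset R I M" and s: "s \<in> S" and t: "t \<in> I" and u: "u \<in> S"
  shows "loc_map \<phi> s (rfrac t u) = mfrac (\<phi> t) (s \<otimes> u)"
proof -
  have "rfrac t u \<in> loc_ideal R S I"
    using loc_ideal_mem_iff t u by auto
  then show ?thesis
    unfolding loc_map_def using loc_hom_frac[OF \<phi> t u] loc_mod_smult[OF one_closed s HM.Zset_closed[OF \<phi> t] u]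
      HM.Zset_closed[OF \<phi> t] by simp
qed

lemma loc_map_add:
  assumes \<phi>: "\<phi> \<in> Zset R I M" and s: "s \<in> S"
    and c: "c \<in> loc_ideal R S I" and d: "d \<in> loc_ideal R S I"
  shows "loc_map \<phi> s (c \<oplus>\<^bsub>loc_ring R S\<^esub> d) = loc_map \<phi> s c \<oplus>\<^bsub>loc_mod R S M\<^esub> loc_map \<phi> s d"
proof -
  obtain t u where tu: "t \<in> I" "u \<in> S" "c = rfrac t u"
    using c by (rule loc_idealE)
  obtain t' u' where tu': "t' \<in> I" "u' \<in> S" "d = rfrac t' u'"
    using d by (rule loc_idealE)
  note C = s[THEN S_carrier] tu(2)[THEN S_carrier] tu'(2)[THEN S_carrier]
    tu(1)[THEN HM.I_carrier] tu'(1)[THEN HM.I_carrier] HM.Zset_closed[OF \<phi> tu(1)] HM.Zset_closed[OF \<phi> tu'(1)]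
  have sum_I: "u' \<otimes> t \<oplus> u \<otimes> t' \<in> I"
    using tu tu' HM.I_add_closed HM.I_mult_closed C by blast
  have "loc_map \<phi> s (c \<oplus>\<^bsub>loc_ring R S\<^esub> d) = mfrac (\<phi> (u' \<otimes> t \<oplus> u \<otimes> t')) (s \<otimes> (u \<otimes> u'))"
    unfolding tu(3) tu'(3) loc_ring_add_frac[OF C(4) tu(2) C(5) tu'(2)]
    using loc_map_frac[OF \<phi> s sum_I] tu tu' S_mult_closed by simp
  also have "\<dots> = mfrac (u' \<odot>\<^bsub>M\<^esub> \<phi> t \<oplus>\<^bsub>M\<^esub> u \<odot>\<^bsub>M\<^esub> \<phi> t') (s \<otimes> (u \<otimes> u'))"
    using HM.ZsetD(2,3)[OF \<phi>] tu tu' C HM.I_mult_closed by simp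
  also have "\<dots> = mfrac ((s \<otimes> u') \<odot>\<^bsub>M\<^esub> \<phi> t \<oplus>\<^bsub>M\<^esub> (s \<otimes> u) \<odot>\<^bsub>M\<^esub> \<phi> t') ((s \<otimes> u) \<otimes> (s \<otimes> u'))"
  proof (rule loc_cls_eqI)
    have "((s \<otimes> u) \<otimes> (s \<otimes> u')) \<otimes> u' = (s \<otimes> (u \<otimes> u')) \<otimes> (s \<otimes> u')"
      and "((s \<otimes> u) \<otimes> (s \<otimes> u')) \<otimes> u = (s \<otimes> (u \<otimes> u')) \<otimes> (s \<otimes> u)"
      using C by algebra+
    then show "((s \<otimes> u) \<otimes> (s \<otimes> u')) \<odot>\<^bsub>M\<^esub> (u' \<odot>\<^bsub>M\<^esub> \<phi> t \<oplus>\<^bsub>M\<^esub> u \<odot>\<^bsub>M\<^esub> \<phi> t') =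
      (s \<otimes> (u \<otimes> u')) \<odot>\<^bsub>M\<^esub> ((s \<otimes> u') \<odot>\<^bsub>M\<^esub> \<phi> t \<oplus>\<^bsub>M\<^esub> (s \<otimes> u) \<odot>\<^bsub>M\<^esub> \<phi> t')"
      using C by (simp add: smult_r_distr smult_assoc1[symmetric])
  qed (use C tu tu' s S_mult_closed in auto)
  also have "\<dots> = loc_map \<phi> s c \<oplus>\<^bsub>loc_mod R S M\<^esub> loc_map \<phi> s d"
    unfolding tu(3) tu'(3) loc_map_frac[OF \<phi> s tu(1,2)] loc_map_frac[OF \<phi> s tu'(1,2)]
    using loc_mod_add C s tu tu' S_mult_closed by simp
  finally show ?thesis .
qed

lemma loc_map_mult:
  assumes \<phi>: "\<phi> \<in> Zset R I M" and s: "s \<in> S"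
    and r: "r \<in> carrier (loc_ring R S)" and c: "c \<in> loc_ideal R S I"
  shows "loc_map \<phi> s (r \<otimes>\<^bsub>loc_ring R S\<^esub> c) = r \<odot>\<^bsub>loc_mod R S M\<^esub> loc_map \<phi> s c"
proof -
  obtain a v where av: "a \<in> carrier R" "v \<in> S" "r = rfrac a v"
    using r loc_ring_carrier_iff by blast
  obtain t u where tu: "t \<in> I" "u \<in> S" "c = rfrac t u"
    using c by (rule loc_idealE)
  note C = s[THEN S_carrier] tu(2)[THEN S_carrier] av(2)[THEN S_carrier] tu(1)[THEN HM.I_carrier] av(1)
    HM.Zset_closed[OF \<phi> tu(1)]
  have "loc_map \<phi> s (r \<otimes>\<^bsub>loc_ring R S\<^esub> c) = mfrac (\<phi> (a \<otimes> t)) (s \<otimes> (v \<otimes> u))"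
    unfolding av(3) tu(3) loc_ring_mult_frac[OF av(1,2) C(4) tu(2)]
    using loc_map_frac[OF \<phi> s HM.I_mult_closed[OF av(1) tu(1)]] av tu S_mult_closed by simp
  also have "\<dots> = mfrac (a \<odot>\<^bsub>M\<^esub> \<phi> t) (v \<otimes> (s \<otimes> u))"
    using HM.ZsetD(3)[OF \<phi> av(1) tu(1)] C by (simp add: m_lcomm)
  also have "\<dots> = r \<odot>\<^bsub>loc_mod R S M\<^esub> loc_map \<phi> s c"
    unfolding av(3) tu(3) loc_map_frac[OF \<phi> s tu(1,2)]
    using loc_mod_smult[OF av(1,2) C(6)] s tu S_mult_closed by simp
  finally show ?thesis .
qed

lemma loc_map_principal:
  assumes \<phi>: "\<phi> \<in> Zset R I M" and s: "s \<in> S" and c: "c \<in> loc_ideal R S I"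
  shows "\<exists>n\<in>carrier (loc_mod R S M). loc_map \<phi> s c = c \<odot>\<^bsub>loc_mod R S M\<^esub> n"
proof -
  obtain t u where tu: "t \<in> I" "u \<in> S" "c = rfrac t u"
    using c by (rule loc_idealE)
  obtain m where m: "m \<in> carrier M" "\<phi> t = t \<odot>\<^bsub>M\<^esub> m"
    using HM.ZsetD(4)[OF \<phi> tu(1)] by blast
  have "c \<odot>\<^bsub>loc_mod R S M\<^esub> mfrac m s = mfrac (t \<odot>\<^bsub>M\<^esub> m) (u \<otimes> s)"
    unfolding tu(3) using loc_mod_smult[OF HM.I_carrier[OF tu(1)] tu(2) m(1) s] .
  also have "\<dots> = loc_map \<phi> s c"
    unfolding tu(3) loc_map_frac[OF \<phi> s tu(1,2)] m(2) using s tu S_carrier by (simp add: m_comm)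
  finally have "loc_map \<phi> s c = c \<odot>\<^bsub>loc_mod R S M\<^esub> mfrac m s" ..
  moreover have "mfrac m s \<in> carrier (loc_mod R S M)"
    unfolding loc_mod_carrier_iff using m(1) s by blast
  ultimately show ?thesis
    by blast
qed

lemma loc_map_Zset:
  assumes \<phi>: "\<phi> \<in> Zset R I M" and s: "s \<in> S"
  shows "loc_map \<phi> s \<in> Zset (loc_ring R S) (loc_ideal R S I) (loc_mod R S M)"
proof -
  have "loc_map \<phi> s \<in> loc_ideal R S I \<rightarrow>\<^sub>E carrier (loc_mod R S M)"
  proof
    fix c assume "c \<in> loc_ideal R S I"
    then obtain t u where "t \<in> I" "u \<in> S" "c = rfrac t u"
      by (rule loc_idealE)
    then show "loc_map \<phi> s c \<in> carrier (loc_mod R S M)"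
      unfolding loc_mod_carrier_iff using loc_map_frac[OF \<phi> s] HM.Zset_closed[OF \<phi>] s S_mult_closed by blast
  qed (simp add: loc_map_def)
  then show ?thesis
    unfolding Zset_def hom_lin_def using loc_map_add[OF \<phi> s] loc_map_mult[OF \<phi> s] loc_map_principal[OF \<phi> s]
    by auto
qed

lemma loc_mod_smult_zero:
  assumes "r \<in> carrier (loc_ring R S)"
  shows "r \<odot>\<^bsub>loc_mod R S M\<^esub> \<zero>\<^bsub>loc_mod R S M\<^esub> = \<zero>\<^bsub>loc_mod R S M\<^esub>"
proof -
  obtain a v where "a \<in> carrier R" "v \<in> S" "r = rfrac a v"
    using assms loc_ring_carrier_iff by blast
  then show ?thesis
    unfolding loc_mod_zero using loc_mod_smult[of a v "\<zero>\<^bsub>M\<^esub>" \<one>] one_in_S S_carrier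
    by (simp add: loc_cls_eqI)
qed

lemma loc_zero_map_Bset:
  "(\<lambda>c\<in>loc_ideal R S I. \<zero>\<^bsub>loc_mod R S M\<^esub>) \<in> Bset (loc_ring R S) (loc_ideal R S I) (loc_mod R S M)"
proof -
  define z where "z = (\<lambda>c\<in>loc_ideal R S I. \<zero>\<^bsub>loc_mod R S M\<^esub>)"
  have principal: "z c = c \<odot>\<^bsub>loc_mod R S M\<^esub> \<zero>\<^bsub>loc_mod R S M\<^esub>" if "c \<in> loc_ideal R S I" for c
    unfolding z_def using that loc_ideal_subset loc_mod_smult_zero by auto
  have "z \<in> loc_ideal R S I \<rightarrow>\<^sub>E carrier (loc_mod R S M)"
    unfolding z_def using loc_mod_zero_closed by simp
  moreover have "z (c \<oplus>\<^bsub>loc_ring R S\<^esub> d) = z c \<oplus>\<^bsub>loc_mod R S M\<^esub> z d"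
    if "c \<in> loc_ideal R S I" "d \<in> loc_ideal R S I" for c d
    unfolding z_def using that loc_ideal_add_closed loc_mod_add_zero[OF loc_mod_zero_closed] by simp
  moreover have "z (r \<otimes>\<^bsub>loc_ring R S\<^esub> c) = r \<odot>\<^bsub>loc_mod R S M\<^esub> z c"
    if "r \<in> carrier (loc_ring R S)" "c \<in> loc_ideal R S I" for r c
    unfolding z_def using that loc_ideal_mult_closed loc_mod_smult_zero by simp
  ultimately have "z \<in> Zset (loc_ring R S) (loc_ideal R S I) (loc_mod R S M)"
    unfolding Zset_def hom_lin_def using principal loc_mod_zero_closed by blast
  then show ?thesis
    unfolding Bset_def z_def[symmetric] using principal loc_mod_zero_closed by blast
qed

lemma loc_Hclass_self:
  assumes "\<psi> \<in> Zset (loc_ring R S) (loc_ideal R S I) (loc_mod R S M)"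
  shows "\<psi> \<in> Hclass (loc_ring R S) (loc_ideal R S I) (loc_mod R S M) \<psi>"
  using Hclass_self_if_zero_map_in_Bset[OF loc_zero_map_Bset] assms loc_mod_add_zero
  unfolding Zset_def hom_lin_def by blast

lemma can_loc_frac:
  assumes \<xi>: "\<xi> \<in> carrier (loc_mod R S (Hmod R I M))"
  obtains \<phi> s where "\<phi> \<in> Zset R I M" "s \<in> S" "\<xi> = loc_cls R S (Hmod R I M) (Hclass R I M \<phi>) s"
    "can_loc R S I M \<xi> = Hclass (loc_ring R S) (loc_ideal R S I) (loc_mod R S M) (loc_map \<phi> s)"
proof -
  obtain x s0 where x: "x \<in> carrier (Hmod R I M)" "s0 \<in> S" "\<xi> = loc_cls R S (Hmod R I M) x s0"
    using \<xi> LH.loc_mod_carrier_iff by auto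
  obtain x' s where p: "(SOME p. p \<in> \<xi>) = (x', s)" "x' \<in> carrier (Hmod R I M)" "s \<in> S"
    "frac_rel R S (Hmod R I M) x s0 x' s"
    using LH.some_loc_cls[OF x(1,2)] unfolding x(3) .
  have \<xi>_eq: "\<xi> = loc_cls R S (Hmod R I M) x' s"
    using LH.loc_cls_eq_iff[OF x(1,2) p(2,3)] p(4) x(3) by simp
  obtain \<phi>0 where \<phi>0: "\<phi>0 \<in> Zset R I M" "x' = Hclass R I M \<phi>0"
    using p(2) by (rule HmodE)
  define \<phi> where "\<phi> = (SOME \<phi>. \<phi> \<in> x')"
  have \<phi>: "\<phi> \<in> Zset R I M" "x' = Hclass R I M \<phi>"
    using HM.some_Hclass[OF \<phi>0(1)] HM.Hclass_eq_iff[OF \<phi>0(1)] unfolding \<phi>_def \<phi>0(2) by auto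
  have "can_loc R S I M \<xi> = Hclass (loc_ring R S) (loc_ideal R S I) (loc_mod R S M) (loc_map \<phi> s)"
    unfolding can_loc_def p(1) loc_map_def \<phi>_def by simp
  then show ?thesis
    using that \<phi> p(3) \<xi>_eq by blast
qed

lemma can_loc_closed:
  "can_loc R S I M \<in> carrier (loc_mod R S (Hmod R I M)) \<rightarrow> carrier (Hmod (loc_ring R S) (loc_ideal R S I) (loc_mod R S M))"
proof
  fix \<xi> assume "\<xi> \<in> carrier (loc_mod R S (Hmod R I M))"
  then obtain \<phi> s where "\<phi> \<in> Zset R I M" "s \<in> S"
    "can_loc R S I M \<xi> = Hclass (loc_ring R S) (loc_ideal R S I) (loc_mod R S M) (loc_map \<phi> s)"
    by (rule can_loc_frac)
  then show "can_loc R S I M \<xi> \<in> carrier (Hmod (loc_ring R S) (loc_ideal R S I) (loc_mod R S M))"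
    using Hclass_in_Hmod loc_map_Zset by metis
qed

lemma can_loc_eq_pointwise:
  assumes \<phi>: "\<phi> \<in> Zset R I M" and \<psi>: "\<psi> \<in> Zset R I M" and s1: "s1 \<in> S" and s2: "s2 \<in> S"
    and eq: "Hclass (loc_ring R S) (loc_ideal R S I) (loc_mod R S M) (loc_map \<phi> s1)
      = Hclass (loc_ring R S) (loc_ideal R S I) (loc_mod R S M) (loc_map \<psi> s2)"
  obtains m w where "m \<in> carrier M" "w \<in> S"
    "\<And>t. t \<in> I \<Longrightarrow> \<exists>v\<in>S. v \<odot>\<^bsub>M\<^esub> ((s2 \<otimes> w) \<odot>\<^bsub>M\<^esub> \<phi> t)
      = v \<odot>\<^bsub>M\<^esub> ((s1 \<otimes> w) \<odot>\<^bsub>M\<^esub> \<psi> t \<oplus>\<^bsub>M\<^esub> t \<odot>\<^bsub>M\<^esub> ((s1 \<otimes> s2) \<odot>\<^bsub>M\<^esub> m))"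
proof -
  have "loc_map \<phi> s1 \<in> Hclass (loc_ring R S) (loc_ideal R S I) (loc_mod R S M) (loc_map \<psi> s2)"
    using loc_Hclass_self[OF loc_map_Zset[OF \<phi> s1]] eq by simp
  then obtain b where b: "b \<in> Bset (loc_ring R S) (loc_ideal R S I) (loc_mod R S M)"
    "loc_map \<phi> s1 = hadd (loc_ideal R S I) (loc_mod R S M) (loc_map \<psi> s2) b"
    unfolding Hclass_def by blast
  then obtain n where n: "n \<in> carrier (loc_mod R S M)" "\<forall>c\<in>loc_ideal R S I. b c = c \<odot>\<^bsub>loc_mod R S M\<^esub> n"
    unfolding Bset_def by blast
  obtain m w where mw: "m \<in> carrier M" "w \<in> S" "n = mfrac m w"
    using n(1) loc_mod_carrier_iff by auto
  have "\<exists>v\<in>S. v \<odot>\<^bsub>M\<^esub> ((s2 \<otimes> w) \<odot>\<^bsub>M\<^esub> \<phi> t)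
      = v \<odot>\<^bsub>M\<^esub> ((s1 \<otimes> w) \<odot>\<^bsub>M\<^esub> \<psi> t \<oplus>\<^bsub>M\<^esub> t \<odot>\<^bsub>M\<^esub> ((s1 \<otimes> s2) \<odot>\<^bsub>M\<^esub> m))"
    if t: "t \<in> I" for t
  proof -
    have tc: "t \<in> carrier R"
      using HM.I_carrier t .
    have t1: "rfrac t \<one> \<in> loc_ideal R S I"
      unfolding loc_ideal_mem_iff using t one_in_S by blast
    note C = s1[THEN S_carrier] s2[THEN S_carrier] mw(2)[THEN S_carrier] tc mw(1)
      HM.Zset_closed[OF \<phi> t] HM.Zset_closed[OF \<psi> t]
    have "mfrac (\<phi> t) s1 = loc_map \<phi> s1 (rfrac t \<one>)"
      using loc_map_frac[OF \<phi> s1 t one_in_S] C by simp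
    also have "\<dots> = loc_map \<psi> s2 (rfrac t \<one>) \<oplus>\<^bsub>loc_mod R S M\<^esub> b (rfrac t \<one>)"
      unfolding b(2) hadd_def using t1 by simp
    also have "\<dots> = mfrac (\<psi> t) s2 \<oplus>\<^bsub>loc_mod R S M\<^esub> mfrac (t \<odot>\<^bsub>M\<^esub> m) w"
      using loc_map_frac[OF \<psi> s2 t one_in_S] n(2) t1 mw(3) loc_mod_smult[OF tc one_in_S mw(1,2)] C by simp
    also have "\<dots> = mfrac (w \<odot>\<^bsub>M\<^esub> \<psi> t \<oplus>\<^bsub>M\<^esub> s2 \<odot>\<^bsub>M\<^esub> (t \<odot>\<^bsub>M\<^esub> m)) (s2 \<otimes> w)"
      using loc_mod_add[OF C(7) s2 smult_closed[OF tc mw(1)] mw(2)] .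
    finally obtain v where v: "v \<in> S"
      "(v \<otimes> (s2 \<otimes> w)) \<odot>\<^bsub>M\<^esub> \<phi> t = (v \<otimes> s1) \<odot>\<^bsub>M\<^esub> (w \<odot>\<^bsub>M\<^esub> \<psi> t \<oplus>\<^bsub>M\<^esub> s2 \<odot>\<^bsub>M\<^esub> (t \<odot>\<^bsub>M\<^esub> m))"
      using loc_cls_eq_iff C S_mult_closed[OF s2 mw(2)] s1 unfolding frac_rel_def by auto
    have "v \<odot>\<^bsub>M\<^esub> ((s2 \<otimes> w) \<odot>\<^bsub>M\<^esub> \<phi> t) = (v \<otimes> (s2 \<otimes> w)) \<odot>\<^bsub>M\<^esub> \<phi> t"
      using C S_carrier[OF v(1)] by (simp add: smult_assoc1)
    also have "\<dots> = (v \<otimes> s1) \<odot>\<^bsub>M\<^esub> (w \<odot>\<^bsub>M\<^esub> \<psi> t \<oplus>\<^bsub>M\<^esub> s2 \<odot>\<^bsub>M\<^esub> (t \<odot>\<^bsub>M\<^esub> m))"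
      by (rule v(2))
    also have "\<dots> = v \<odot>\<^bsub>M\<^esub> ((s1 \<otimes> w) \<odot>\<^bsub>M\<^esub> \<psi> t \<oplus>\<^bsub>M\<^esub> t \<odot>\<^bsub>M\<^esub> ((s1 \<otimes> s2) \<odot>\<^bsub>M\<^esub> m))"
      using C S_carrier[OF v(1)] by (simp add: smult_r_distr smult_assoc1[symmetric] m_ac)
    finally show ?thesis
      using v(1) by blast
  qed
  then show ?thesis
    using that mw(1,2) by blast
qed

lemma loc_Hmod_eqI:
  assumes fg: "fin_gen_ideal R I" and \<phi>: "\<phi> \<in> Zset R I M" and \<psi>: "\<psi> \<in> Zset R I M"
    and s1: "s1 \<in> S" and s2: "s2 \<in> S" and m: "m \<in> carrier M" and w: "w \<in> S"
    and pointwise: "\<And>t. t \<in> I \<Longrightarrow> \<exists>v\<in>S. v \<odot>\<^bsub>M\<^esub> ((s2 \<otimes> w) \<odot>\<^bsub>M\<^esub> \<phi> t)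
      = v \<odot>\<^bsub>M\<^esub> ((s1 \<otimes> w) \<odot>\<^bsub>M\<^esub> \<psi> t \<oplus>\<^bsub>M\<^esub> t \<odot>\<^bsub>M\<^esub> ((s1 \<otimes> s2) \<odot>\<^bsub>M\<^esub> m))"
  shows "loc_cls R S (Hmod R I M) (Hclass R I M \<phi>) s1 = loc_cls R S (Hmod R I M) (Hclass R I M \<psi>) s2"
proof -
  obtain G where G: "finite G" "G \<subseteq> carrier R" "I = Idl G"
    using fg unfolding fin_gen_ideal_def by auto
  note C = s1[THEN S_carrier] s2[THEN S_carrier] w[THEN S_carrier]
  define n where "n = (s1 \<otimes> s2) \<odot>\<^bsub>M\<^esub> m"
  have n: "n \<in> carrier M"
    unfolding n_def using C m by simp
  define \<chi>1 where "\<chi>1 = hsmult I M (s2 \<otimes> w) \<phi>"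
  define \<chi>2 where "\<chi>2 = hadd I M (hsmult I M (s1 \<otimes> w) \<psi>) (\<lambda>t\<in>I. t \<odot>\<^bsub>M\<^esub> n)"
  have "\<chi>1 \<in> hom_lin R (Idl G) M" "\<chi>2 \<in> hom_lin R (Idl G) M"
    unfolding \<chi>1_def \<chi>2_def G(3)[symmetric]
    using HM.hsmult_Zset HM.hadd_Zset HM.principal_Zset[OF n] C \<phi> \<psi> Zset_subset_hom_lin by blast+
  moreover have "\<exists>v\<in>S. v \<odot>\<^bsub>M\<^esub> \<chi>1 t = v \<odot>\<^bsub>M\<^esub> \<chi>2 t" if "t \<in> Idl G" for t
    using pointwise that G(3) unfolding \<chi>1_def \<chi>2_def hsmult_def hadd_def n_def by auto
  ultimately obtain V where V: "V \<in> S" "\<And>t. t \<in> I \<Longrightarrow> V \<odot>\<^bsub>M\<^esub> \<chi>1 t = V \<odot>\<^bsub>M\<^esub> \<chi>2 t"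
    using hom_lin_eq_after_scaling[OF G(1,2)] G(3) by metis
  have "(V \<otimes> w \<otimes> s2) \<odot>\<^bsub>M\<^esub> \<phi> t = (V \<otimes> w \<otimes> s1) \<odot>\<^bsub>M\<^esub> \<psi> t \<oplus>\<^bsub>M\<^esub> t \<odot>\<^bsub>M\<^esub> (V \<odot>\<^bsub>M\<^esub> n)"
    if t: "t \<in> I" for t
    using V(2)[OF t] C S_carrier[OF V(1)] HM.Zset_closed[OF \<phi> t] HM.Zset_closed[OF \<psi> t] HM.I_carrier[OF t] n t
    unfolding \<chi>1_def \<chi>2_def hsmult_def hadd_def
    by (simp add: smult_r_distr smult_assoc1[symmetric] m_ac)
  then have "cohomologous I M (hsmult I M (V \<otimes> w \<otimes> s1) \<psi>) (hsmult I M (V \<otimes> w \<otimes> s2) \<phi>)"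
    unfolding cohomologous_def hsmult_def using n S_carrier[OF V(1)] by auto
  then have "Hclass R I M (hsmult I M (V \<otimes> w \<otimes> s1) \<psi>) = Hclass R I M (hsmult I M (V \<otimes> w \<otimes> s2) \<phi>)"
    using HM.Hclass_eq_iff HM.hsmult_Zset C S_carrier[OF V(1)] \<phi> \<psi> by simp
  then have "(V \<otimes> w \<otimes> s2) \<odot>\<^bsub>Hmod R I M\<^esub> Hclass R I M \<phi> = (V \<otimes> w \<otimes> s1) \<odot>\<^bsub>Hmod R I M\<^esub> Hclass R I M \<psi>"
    using C S_carrier[OF V(1)] \<phi> \<psi> by (simp add: HM.Hmod_smult)
  then have "frac_rel R S (Hmod R I M) (Hclass R I M \<phi>) s1 (Hclass R I M \<psi>) s2"
    unfolding frac_rel_def using S_mult_closed[OF V(1) w] by blast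
  then show ?thesis
    using LH.loc_cls_eq_iff Hclass_in_Hmod \<phi> \<psi> s1 s2 by blast
qed

lemma can_loc_inj:
  assumes fg: "fin_gen_ideal R I"
  shows "inj_on (can_loc R S I M) (carrier (loc_mod R S (Hmod R I M)))"
proof (rule inj_onI)
  fix \<xi> \<xi>' assume \<xi>: "\<xi> \<in> carrier (loc_mod R S (Hmod R I M))" and \<xi>': "\<xi>' \<in> carrier (loc_mod R S (Hmod R I M))"
    and eq: "can_loc R S I M \<xi> = can_loc R S I M \<xi>'"
  obtain \<phi> s1 where \<phi>: "\<phi> \<in> Zset R I M" "s1 \<in> S" "\<xi> = loc_cls R S (Hmod R I M) (Hclass R I M \<phi>) s1"
    "can_loc R S I M \<xi> = Hclass (loc_ring R S) (loc_ideal R S I) (loc_mod R S M) (loc_map \<phi> s1)"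
    using \<xi> by (rule can_loc_frac)
  obtain \<psi> s2 where \<psi>: "\<psi> \<in> Zset R I M" "s2 \<in> S" "\<xi>' = loc_cls R S (Hmod R I M) (Hclass R I M \<psi>) s2"
    "can_loc R S I M \<xi>' = Hclass (loc_ring R S) (loc_ideal R S I) (loc_mod R S M) (loc_map \<psi> s2)"
    using \<xi>' by (rule can_loc_frac)
  obtain m w where "m \<in> carrier M" "w \<in> S"
    "\<And>t. t \<in> I \<Longrightarrow> \<exists>v\<in>S. v \<odot>\<^bsub>M\<^esub> ((s2 \<otimes> w) \<odot>\<^bsub>M\<^esub> \<phi> t)
      = v \<odot>\<^bsub>M\<^esub> ((s1 \<otimes> w) \<odot>\<^bsub>M\<^esub> \<psi> t \<oplus>\<^bsub>M\<^esub> t \<odot>\<^bsub>M\<^esub> ((s1 \<otimes> s2) \<odot>\<^bsub>M\<^esub> m))"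
    using can_loc_eq_pointwise[OF \<phi>(1) \<psi>(1) \<phi>(2) \<psi>(2)] eq \<phi>(4) \<psi>(4) by metis
  then show "\<xi> = \<xi>'"
    unfolding \<phi>(3) \<psi>(3) by (rule loc_Hmod_eqI[OF fg \<phi>(1) \<psi>(1) \<phi>(2) \<psi>(2)])
qed

end

theorem proposition5p5:
  fixes R :: "'a ring" and I :: "'a set" and M :: "('a, 'b) module"
    and \<Lambda> :: "'l set" and Ms :: "'l \<Rightarrow> ('a, 'c) module" and S :: "'a set"
  assumes "cring R" and "ideal I R" and "module R M"
    and "\<forall>l\<in>\<Lambda>. module R (Ms l)"
  shows "is_mod_iso R (Hmod R I (prod_mod R \<Lambda> Ms)) (prod_mod R \<Lambda> (\<lambda>l. Hmod R I (Ms l)))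
           (can_prod R I \<Lambda> Ms)
    \<and> (fin_gen_ideal R I \<longrightarrow>
         is_mod_iso R (Hmod R I (dsum_mod R \<Lambda> Ms)) (dsum_mod R \<Lambda> (\<lambda>l. Hmod R I (Ms l)))
           (can_prod R I \<Lambda> Ms))
    \<and> (let J = ann_mod R M in
         bij_betw (can_quot R I J M) (carrier (Hmod R I M))
           (carrier (Hmod (R Quot J) (quot_ideal R I J) (quot_mod R J M)))
       \<and> (\<forall>Xa\<in>carrier (Hmod R I M). \<forall>Ya\<in>carrier (Hmod R I M).
            can_quot R I J M (Xa \<oplus>\<^bsub>Hmod R I M\<^esub> Ya)
            = can_quot R I J M Xa \<oplus>\<^bsub>Hmod (R Quot J) (quot_ideal R I J) (quot_mod R J M)\<^esub> can_quot R I J M Ya)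
       \<and> (\<forall>r\<in>carrier R. \<forall>Xa\<in>carrier (Hmod R I M).
            can_quot R I J M (r \<odot>\<^bsub>Hmod R I M\<^esub> Xa)
            = (J +>\<^bsub>R\<^esub> r) \<odot>\<^bsub>Hmod (R Quot J) (quot_ideal R I J) (quot_mod R J M)\<^esub> can_quot R I J M Xa))
    \<and> (mult_set R S \<and> fin_gen_ideal R I \<longrightarrow>
         can_loc R S I M \<in> carrier (loc_mod R S (Hmod R I M))
            \<rightarrow> carrier (Hmod (loc_ring R S) (loc_ideal R S I) (loc_mod R S M))
       \<and> inj_on (can_loc R S I M) (carrier (loc_mod R S (Hmod R I M))))"
proof -
  have Ms: "\<And>l. l \<in> \<Lambda> \<Longrightarrow> module R (Ms l)"
    using assms(4) by blast
  interpret M: module R M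
    by fact
  interpret Q: annihilator_quotient R M I "ann_mod R M"
    by (intro annihilator_quotient.intro annihilator_quotient_axioms.intro assms M.ann_mod_ideal)
      (auto simp: ann_mod_def)
  have localization: "can_loc R S I M \<in> carrier (loc_mod R S (Hmod R I M))
      \<rightarrow> carrier (Hmod (loc_ring R S) (loc_ideal R S I) (loc_mod R S M))
    \<and> inj_on (can_loc R S I M) (carrier (loc_mod R S (Hmod R I M)))"
    if "mult_set R S \<and> fin_gen_ideal R I"
  proof -
    interpret L: H_localization R M S I
      by (intro H_localization.intro mult_set_module.intro mult_set_module_axioms.intro
          H_localization_axioms.intro assms conjunct1[OF that])
    show ?thesis
      using L.can_loc_closed L.can_loc_inj conjunct2[OF that] by blast
  qed
  show ?thesis
    unfolding Let_def
    by (intro conjI impI ballI Hmod_prod_iso[OF assms(1,2) Ms] Hmod_dsum_iso[OF assms(1,2) Ms]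
        Q.can_quot_bij Q.can_quot_add Q.can_quot_smult)
      (simp_all add: localization)
qed

end
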